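(* Let $\phi:\mathbb{P}^n\to\mathbb{P}^n$ be an endomorphism of degree $d>1$ defined over $\mathbb{C}$. Let $T$ be an irreducible complex algebraic variety and $t\mapsto\psi_t$ a family of endomorphisms parametrized by $T$ (a morphism $T\to\mathrm{Mor}^n_d$) such that $\phi\circ\psi_t=\psi_t\circ\phi$ for all $t\in T$. Then $\psi_s=\psi_t$ for all $s,t\in T$.
   Context: $\mathrm{Mor}^n_d$ denotes the space of endomorphisms $\mathbb{P}^n\to\mathbb{P}^n$ of degree $d$, viewed as a Zariski open subset of the projective space $\mathbb{P}^N$ of coefficient tuples $[a_{iJ}]$ of $(n+1)$-tuples of homogeneous polynomials of degree $d$ (the locus where the resultant is nonzero). *)

theory Defs
  imports "HOL-Analysis.Abstract_Topology" "HOL-Library.Poly_Mapping" Complex_Main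
begin

section \<open>Multivariate polynomials over the complex numbers\<close>

text \<open>Monomials are finitely supported exponent functions, and polynomials are finitely supported
  functions from monomials to coefficients. With the convolution product of
  \<^theory>\<open>HOL-Library.Poly_Mapping\<close>, \<open>'v cpoly\<close> is the polynomial ring with the elements of
  \<open>'v\<close> as indeterminates.\<close>

type_synonym 'v monom = "'v \<Rightarrow>\<^sub>0 nat"
type_synonym 'v cpoly = "'v monom \<Rightarrow>\<^sub>0 complex"

definition monom_degree :: "'v monom \<Rightarrow> nat" where
  "monom_degree J = (\<Sum>i\<in>Poly_Mapping.keys J. Poly_Mapping.lookup J i)"

definition monom_eval :: "'v monom \<Rightarrow> ('v \<Rightarrow> complex) \<Rightarrow> complex" where
  "monom_eval J x = (\<Prod>i\<in>Poly_Mapping.keys J. x i ^ Poly_Mapping.lookup J i)"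

definition poly_eval :: "'v cpoly \<Rightarrow> ('v \<Rightarrow> complex) \<Rightarrow> complex" where
  "poly_eval p x = (\<Sum>J\<in>Poly_Mapping.keys p. Poly_Mapping.lookup p J * monom_eval J x)"

definition polys_in :: "'v set \<Rightarrow> 'v cpoly set" where
  "polys_in I = {p. \<forall>J\<in>Poly_Mapping.keys p. Poly_Mapping.keys J \<subseteq> I}"

definition forms_in :: "'v set \<Rightarrow> nat \<Rightarrow> 'v cpoly set" where
  "forms_in I d = {p \<in> polys_in I. \<forall>J\<in>Poly_Mapping.keys p. monom_degree J = d}"

lemma monom_eval_superset:
  assumes "finite A" "Poly_Mapping.keys J \<subseteq> A"
  shows "monom_eval J x = (\<Prod>i\<in>A. x i ^ Poly_Mapping.lookup J i)"
  unfolding monom_eval_def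
  by (rule prod.mono_neutral_left) (use assms in \<open>auto simp: in_keys_iff\<close>)

lemma monom_degree_superset:
  assumes "finite A" "Poly_Mapping.keys J \<subseteq> A"
  shows "monom_degree J = (\<Sum>i\<in>A. Poly_Mapping.lookup J i)"
  unfolding monom_degree_def
  by (rule sum.mono_neutral_left) (use assms in \<open>auto simp: in_keys_iff\<close>)

lemma monom_eval_add: "monom_eval (J + K) x = monom_eval J x * monom_eval K x"
proof -
  let ?A = "Poly_Mapping.keys J \<union> Poly_Mapping.keys K"
  have "monom_eval (J + K) x = (\<Prod>i\<in>?A. x i ^ Poly_Mapping.lookup (J + K) i)"
    by (rule monom_eval_superset) (use keys_add[of J K] in auto)
  also have "\<dots> = (\<Prod>i\<in>?A. x i ^ Poly_Mapping.lookup J i) * (\<Prod>i\<in>?A. x i ^ Poly_Mapping.lookup K i)"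
    by (simp add: lookup_add power_add prod.distrib)
  also have "\<dots> = monom_eval J x * monom_eval K x"
    by (simp add: monom_eval_superset[of ?A])
  finally show ?thesis .
qed

lemma monom_degree_add: "monom_degree (J + K) = monom_degree J + monom_degree K"
proof -
  let ?A = "Poly_Mapping.keys J \<union> Poly_Mapping.keys K"
  have "monom_degree (J + K) = (\<Sum>i\<in>?A. Poly_Mapping.lookup (J + K) i)"
    by (rule monom_degree_superset) (use keys_add[of J K] in auto)
  also have "\<dots> = (\<Sum>i\<in>?A. Poly_Mapping.lookup J i) + (\<Sum>i\<in>?A. Poly_Mapping.lookup K i)"
    by (simp add: lookup_add sum.distrib)
  also have "\<dots> = monom_degree J + monom_degree K"
    by (simp add: monom_degree_superset[of ?A])
  finally show ?thesis .
qed

lemma monom_eval_scale: "monom_eval J (\<lambda>i. c * x i) = c ^ monom_degree J * monom_eval J x"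
  by (simp add: monom_eval_def monom_degree_def power_mult_distrib prod.distrib power_sum)

lemma poly_eval_superset:
  assumes "finite A" "Poly_Mapping.keys p \<subseteq> A"
  shows "poly_eval p x = (\<Sum>J\<in>A. Poly_Mapping.lookup p J * monom_eval J x)"
  unfolding poly_eval_def
  by (rule sum.mono_neutral_left) (use assms in \<open>auto simp: in_keys_iff\<close>)

lemma poly_eval_zero [simp]: "poly_eval 0 x = 0"
  by (simp add: poly_eval_def)

lemma poly_eval_one [simp]: "poly_eval 1 x = 1"
  by (simp add: poly_eval_def monom_eval_def)

lemma poly_eval_single: "poly_eval (Poly_Mapping.single J c) x = c * monom_eval J x"
  by (simp add: poly_eval_def)

lemma poly_eval_add: "poly_eval (p + q) x = poly_eval p x + poly_eval q x"
proof -
  let ?A = "Poly_Mapping.keys p \<union> Poly_Mapping.keys q"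
  have "poly_eval (p + q) x = (\<Sum>J\<in>?A. Poly_Mapping.lookup (p + q) J * monom_eval J x)"
    by (rule poly_eval_superset) (use keys_add[of p q] in auto)
  also have "\<dots> = poly_eval p x + poly_eval q x"
    by (simp add: lookup_add distrib_right sum.distrib poly_eval_superset[of ?A])
  finally show ?thesis .
qed

lemma poly_eval_sum: "poly_eval (\<Sum>k\<in>A. p k) x = (\<Sum>k\<in>A. poly_eval (p k) x)"
  by (induction A rule: infinite_finite_induct) (auto simp: poly_eval_add)

lemma cpoly_expand: "(p :: 'v cpoly) = (\<Sum>J\<in>Poly_Mapping.keys p. Poly_Mapping.single J (Poly_Mapping.lookup p J))"
  by (rule poly_mapping_eqI) (auto simp: lookup_sum lookup_single when_def in_keys_iff)

lemma poly_eval_mult: "poly_eval (p * q) x = poly_eval p x * poly_eval q x"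
proof -
  have "p * q = (\<Sum>J\<in>Poly_Mapping.keys p. \<Sum>K\<in>Poly_Mapping.keys q.
      Poly_Mapping.single (J + K) (Poly_Mapping.lookup p J * Poly_Mapping.lookup q K))"
    by (subst cpoly_expand[of p], subst cpoly_expand[of q]) (simp add: sum_product mult_single)
  then show ?thesis
    by (simp add: poly_eval_sum poly_eval_single monom_eval_add)
       (simp add: poly_eval_def sum_product mult_ac)
qed

lemma polys_in_mult: "p \<in> polys_in I \<Longrightarrow> q \<in> polys_in I \<Longrightarrow> p * q \<in> polys_in I"
  unfolding polys_in_def
proof safe
  fix J i
  assume p: "\<forall>J\<in>Poly_Mapping.keys p. Poly_Mapping.keys J \<subseteq> I"
    and q: "\<forall>J\<in>Poly_Mapping.keys q. Poly_Mapping.keys J \<subseteq> I"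
    and J: "J \<in> Poly_Mapping.keys (p * q)" and i: "i \<in> Poly_Mapping.keys J"
  obtain K L where "J = K + L" "K \<in> Poly_Mapping.keys p" "L \<in> Poly_Mapping.keys q"
    using J keys_mult[of p q] by blast
  then show "i \<in> I"
    using i p q keys_add[of K L] by blast
qed

lemma forms_in_mult:
  assumes "p \<in> forms_in I d" "q \<in> forms_in I e"
  shows "p * q \<in> forms_in I (d + e)"
proof -
  have "p * q \<in> polys_in I"
    using assms by (auto simp: forms_in_def intro: polys_in_mult)
  moreover have "monom_degree J = d + e" if J: "J \<in> Poly_Mapping.keys (p * q)" for J
  proof -
    obtain K L where "J = K + L" "K \<in> Poly_Mapping.keys p" "L \<in> Poly_Mapping.keys q"
      using J keys_mult[of p q] by blast
    then show ?thesis
      using assms by (simp add: forms_in_def monom_degree_add)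
  qed
  ultimately show ?thesis
    by (simp add: forms_in_def)
qed


section \<open>Affine space and its Zariski topology\<close>

text \<open>For a finite set \<open>I\<close>, a point of \<open>\<complex>\<^sup>I\<close> is a function that vanishes outside \<open>I\<close>;
  affine \<open>m\<close>-space is the case \<open>I = {..<m}\<close>.\<close>

definition affine_space :: "'v set \<Rightarrow> ('v \<Rightarrow> complex) set" where
  "affine_space I = {x. \<forall>i. i \<notin> I \<longrightarrow> x i = 0}"

definition affine_zeros :: "'v set \<Rightarrow> 'v cpoly set \<Rightarrow> ('v \<Rightarrow> complex) set" where
  "affine_zeros I S = {x \<in> affine_space I. \<forall>p\<in>S. poly_eval p x = 0}"

definition algebraic_set :: "'v set \<Rightarrow> ('v \<Rightarrow> complex) set \<Rightarrow> bool" where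
  "algebraic_set I V \<longleftrightarrow> (\<exists>S. S \<subseteq> polys_in I \<and> V = affine_zeros I S)"

definition affine_zariski :: "'v set \<Rightarrow> ('v \<Rightarrow> complex) topology" where
  "affine_zariski I = topology (\<lambda>U. U \<subseteq> affine_space I \<and> algebraic_set I (affine_space I - U))"

lemma affine_zeros_Un:
  "affine_zeros I S \<union> affine_zeros I S' = affine_zeros I {p * q |p q. p \<in> S \<and> q \<in> S'}"
proof (intro set_eqI)
  fix x
  have "(\<forall>r\<in>{p * q |p q. p \<in> S \<and> q \<in> S'}. poly_eval r x = 0) \<longleftrightarrow>
      (\<forall>p\<in>S. \<forall>q\<in>S'. poly_eval (p * q) x = 0)"
    by blast
  then show "x \<in> affine_zeros I S \<union> affine_zeros I S' \<longleftrightarrow>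
      x \<in> affine_zeros I {p * q |p q. p \<in> S \<and> q \<in> S'}"
    unfolding affine_zeros_def Un_iff mem_Collect_eq poly_eval_mult mult_eq_0_iff by blast
qed

lemma openin_affine_zariski:
  "openin (affine_zariski I) U \<longleftrightarrow> U \<subseteq> affine_space I \<and> algebraic_set I (affine_space I - U)"
proof -
  have "istopology (\<lambda>U. U \<subseteq> affine_space I \<and> algebraic_set I (affine_space I - U))"
    unfolding istopology_def
  proof (intro conjI allI impI)
    fix U W
    assume U: "U \<subseteq> affine_space I \<and> algebraic_set I (affine_space I - U)"
      and W: "W \<subseteq> affine_space I \<and> algebraic_set I (affine_space I - W)"
    then show "U \<inter> W \<subseteq> affine_space I" by auto
    from U obtain S where S: "S \<subseteq> polys_in I" "affine_space I - U = affine_zeros I S"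
      by (auto simp: algebraic_set_def)
    from W obtain S' where S': "S' \<subseteq> polys_in I" "affine_space I - W = affine_zeros I S'"
      by (auto simp: algebraic_set_def)
    have "affine_space I - U \<inter> W = affine_zeros I {p * q |p q. p \<in> S \<and> q \<in> S'}"
      using S(2) S'(2) unfolding affine_zeros_Un[symmetric] by auto
    moreover have "{p * q |p q. p \<in> S \<and> q \<in> S'} \<subseteq> polys_in I"
      using S(1) S'(1) by (auto intro: polys_in_mult)
    ultimately show "algebraic_set I (affine_space I - U \<inter> W)"
      unfolding algebraic_set_def by blast
  next
    fix \<U> assume U: "\<forall>U\<in>\<U>. U \<subseteq> affine_space I \<and> algebraic_set I (affine_space I - U)"
    then show "\<Union>\<U> \<subseteq> affine_space I" by auto
    from U have "\<forall>U\<in>\<U>. \<exists>S. S \<subseteq> polys_in I \<and> affine_space I - U = affine_zeros I S"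
      by (simp add: algebraic_set_def)
    then obtain S where S: "\<And>U. U \<in> \<U> \<Longrightarrow> S U \<subseteq> polys_in I"
        "\<And>U. U \<in> \<U> \<Longrightarrow> affine_space I - U = affine_zeros I (S U)"
      by metis
    have "x \<in> affine_space I - \<Union>\<U> \<longleftrightarrow> x \<in> affine_zeros I (\<Union>U\<in>\<U>. S U)" for x
    proof -
      have "x \<in> affine_space I - \<Union>\<U> \<longleftrightarrow> x \<in> affine_space I \<and> (\<forall>U\<in>\<U>. x \<in> affine_space I - U)"
        by auto
      also have "\<dots> \<longleftrightarrow> x \<in> affine_zeros I (\<Union>U\<in>\<U>. S U)"
        using S(2) by (auto simp: affine_zeros_def)
      finally show ?thesis .
    qed
    then have "affine_space I - \<Union>\<U> = affine_zeros I (\<Union>U\<in>\<U>. S U)" by blast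
    moreover have "(\<Union>U\<in>\<U>. S U) \<subseteq> polys_in I" using S(1) by blast
    ultimately show "algebraic_set I (affine_space I - \<Union>\<U>)"
      unfolding algebraic_set_def by blast
  qed
  then show ?thesis
    by (simp add: affine_zariski_def topology_inverse')
qed


section \<open>Projective space and its Zariski topology\<close>

text \<open>A point of projective space is the set of all its homogeneous coordinate vectors;
  projective \<open>n\<close>-space is the case \<open>I = {..n}\<close>.\<close>

definition proj_point :: "('v \<Rightarrow> complex) \<Rightarrow> ('v \<Rightarrow> complex) set" where
  "proj_point x = {\<lambda>i. c * x i |c. c \<noteq> 0}"

definition proj_space :: "'v set \<Rightarrow> ('v \<Rightarrow> complex) set set" where
  "proj_space I = proj_point ` (affine_space I - {\<lambda>_. 0})"

definition proj_zeros :: "'v set \<Rightarrow> 'v cpoly set \<Rightarrow> ('v \<Rightarrow> complex) set set" where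
  "proj_zeros I S = {L \<in> proj_space I. \<forall>p\<in>S. \<forall>x\<in>L. poly_eval p x = 0}"

definition proj_algebraic_set :: "'v set \<Rightarrow> ('v \<Rightarrow> complex) set set \<Rightarrow> bool" where
  "proj_algebraic_set I V \<longleftrightarrow> (\<exists>S. S \<subseteq> (\<Union>e. forms_in I e) \<and> V = proj_zeros I S)"

definition proj_zariski :: "'v set \<Rightarrow> ('v \<Rightarrow> complex) set topology" where
  "proj_zariski I = topology (\<lambda>U. U \<subseteq> proj_space I \<and> proj_algebraic_set I (proj_space I - U))"

lemma form_eval_scale:
  "p \<in> forms_in I e \<Longrightarrow> poly_eval p (\<lambda>i. c * x i) = c ^ e * poly_eval p x"
  by (auto simp: forms_in_def poly_eval_def monom_eval_scale sum_distrib_left mult_ac intro!: sum.cong)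

lemma proj_space_rep:
  assumes "L \<in> proj_space I" "x \<in> L"
  shows "x \<in> affine_space I" "x \<noteq> (\<lambda>_. 0)" "L = proj_point x"
proof -
  obtain y c where y: "y \<in> affine_space I" "y \<noteq> (\<lambda>_. 0)" "L = proj_point y"
      and c: "c \<noteq> 0" "x = (\<lambda>i. c * y i)"
    using assms by (auto simp: proj_space_def proj_point_def)
  show "x \<in> affine_space I" "x \<noteq> (\<lambda>_. 0)"
    using y c by (auto simp: affine_space_def fun_eq_iff)
  have "(\<lambda>i. a * y i) = (\<lambda>i. (a / c) * x i)" "(\<lambda>i. a * x i) = (\<lambda>i. (a * c) * y i)" for a
    using c by auto
  then show "L = proj_point x"
    unfolding y(3) proj_point_def using c(1)
    by (metis (no_types, opaque_lifting) divide_eq_0_iff mult_eq_0_iff)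
qed

lemma forms_products:
  assumes "S \<subseteq> (\<Union>e. forms_in I e)" "S' \<subseteq> (\<Union>e. forms_in I e)"
  shows "{p * q |p q. p \<in> S \<and> q \<in> S'} \<subseteq> (\<Union>e. forms_in I e)"
proof safe
  fix p q assume "p \<in> S" "q \<in> S'"
  then obtain d e where "p \<in> forms_in I d" "q \<in> forms_in I e"
    using assms by blast
  then show "p * q \<in> (\<Union>e. forms_in I e)"
    using forms_in_mult by blast
qed

lemma proj_zeros_Un:
  fixes S S' :: "'v cpoly set"
  assumes "S \<subseteq> (\<Union>e. forms_in I e)" "S' \<subseteq> (\<Union>e. forms_in I e)"
  shows "proj_zeros I S \<union> proj_zeros I S' = proj_zeros I {p * q |p q. p \<in> S \<and> q \<in> S'}"
proof -
  have rep: "(\<forall>x\<in>L. poly_eval p x = 0) \<longleftrightarrow> poly_eval p x = 0"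
    if "L \<in> proj_space I" "x \<in> L" "p \<in> (\<Union>e. forms_in I e)" for L x p
    using that(3) proj_space_rep(3)[OF that(1,2)] that(2) by (auto simp: proj_point_def form_eval_scale)
  have "L \<in> proj_zeros I S \<union> proj_zeros I S' \<longleftrightarrow> L \<in> proj_zeros I {p * q |p q. p \<in> S \<and> q \<in> S'}"
    if L: "L \<in> proj_space I" for L
  proof -
    obtain y where "L = proj_point y" using L by (auto simp: proj_space_def)
    then have x: "y \<in> L" by (auto simp: proj_point_def intro!: exI[of _ 1])
    have mem: "L \<in> proj_zeros I R \<longleftrightarrow> (\<forall>p\<in>R. poly_eval p y = 0)" if "R \<subseteq> (\<Union>e. forms_in I e)" for R
    proof -
      have "(\<forall>x\<in>L. poly_eval p x = 0) \<longleftrightarrow> poly_eval p y = 0" if "p \<in> R" for p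
        using rep[OF L x] \<open>R \<subseteq> _\<close> that by blast
      then show ?thesis
        unfolding proj_zeros_def using L by simp
    qed
    have products: "(\<forall>r\<in>{p * q |p q. p \<in> S \<and> q \<in> S'}. poly_eval r y = 0) \<longleftrightarrow>
        (\<forall>p\<in>S. \<forall>q\<in>S'. poly_eval (p * q) y = 0)"
      by blast
    have "{p * q |p q. p \<in> S \<and> q \<in> S'} \<subseteq> (\<Union>e. forms_in I e)"
      by (rule forms_products[OF assms])
    then show ?thesis
      using mem[OF assms(1)] mem[OF assms(2)] mem[of "{p * q |p q. p \<in> S \<and> q \<in> S'}"]
      unfolding Un_iff by (simp only: products poly_eval_mult mult_eq_0_iff) blast
  qed
  moreover have "proj_zeros I R \<subseteq> proj_space I" for R :: "'v cpoly set"
    unfolding proj_zeros_def by blast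
  ultimately show ?thesis by blast
qed

lemma openin_proj_zariski:
  "openin (proj_zariski I) U \<longleftrightarrow> U \<subseteq> proj_space I \<and> proj_algebraic_set I (proj_space I - U)"
proof -
  have "istopology (\<lambda>U. U \<subseteq> proj_space I \<and> proj_algebraic_set I (proj_space I - U))"
    unfolding istopology_def
  proof (intro conjI allI impI)
    fix U W
    assume U: "U \<subseteq> proj_space I \<and> proj_algebraic_set I (proj_space I - U)"
      and W: "W \<subseteq> proj_space I \<and> proj_algebraic_set I (proj_space I - W)"
    then show "U \<inter> W \<subseteq> proj_space I" by auto
    from U obtain S where S: "S \<subseteq> (\<Union>e. forms_in I e)" "proj_space I - U = proj_zeros I S"
      by (auto simp: proj_algebraic_set_def)
    from W obtain S' where S': "S' \<subseteq> (\<Union>e. forms_in I e)" "proj_space I - W = proj_zeros I S'"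
      by (auto simp: proj_algebraic_set_def)
    have "proj_space I - U \<inter> W = proj_zeros I {p * q |p q. p \<in> S \<and> q \<in> S'}"
      using S(2) S'(2) unfolding proj_zeros_Un[OF S(1) S'(1), symmetric] by auto
    moreover have "{p * q |p q. p \<in> S \<and> q \<in> S'} \<subseteq> (\<Union>e. forms_in I e)"
      by (rule forms_products[OF S(1) S'(1)])
    ultimately show "proj_algebraic_set I (proj_space I - U \<inter> W)"
      unfolding proj_algebraic_set_def by blast
  next
    fix \<U> assume U: "\<forall>U\<in>\<U>. U \<subseteq> proj_space I \<and> proj_algebraic_set I (proj_space I - U)"
    then show "\<Union>\<U> \<subseteq> proj_space I" by auto
    from U have "\<forall>U\<in>\<U>. \<exists>S. S \<subseteq> (\<Union>e. forms_in I e) \<and> proj_space I - U = proj_zeros I S"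
      by (simp add: proj_algebraic_set_def)
    then obtain S where S: "\<And>U. U \<in> \<U> \<Longrightarrow> S U \<subseteq> (\<Union>e. forms_in I e)"
        "\<And>U. U \<in> \<U> \<Longrightarrow> proj_space I - U = proj_zeros I (S U)"
      by metis
    have "x \<in> proj_space I - \<Union>\<U> \<longleftrightarrow> x \<in> proj_zeros I (\<Union>U\<in>\<U>. S U)" for x
    proof -
      have "x \<in> proj_space I - \<Union>\<U> \<longleftrightarrow> x \<in> proj_space I \<and> (\<forall>U\<in>\<U>. x \<in> proj_space I - U)"
        by auto
      also have "\<dots> \<longleftrightarrow> x \<in> proj_zeros I (\<Union>U\<in>\<U>. S U)"
        using S(2) by (auto simp: proj_zeros_def)
      finally show ?thesis .
    qed
    then have "proj_space I - \<Union>\<U> = proj_zeros I (\<Union>U\<in>\<U>. S U)" by blast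
    moreover have "(\<Union>U\<in>\<U>. S U) \<subseteq> (\<Union>e. forms_in I e)" using S(1) by blast
    ultimately show "proj_algebraic_set I (proj_space I - \<Union>\<U>)"
      unfolding proj_algebraic_set_def by blast
  qed
  then show ?thesis
    by (simp add: proj_zariski_def topology_inverse')
qed


section \<open>Spaces with functions and varieties\<close>

text \<open>A space with functions is a topological space with a sheaf of complex-valued functions.
  \<open>reg X U\<close> is the set of regular functions on the open set \<open>U\<close>. Its members are total functions
  whose values outside \<open>U\<close> are irrelevant; only the values of \<open>reg X\<close> at open sets matter.\<close>

record 'a fun_space =
  zar :: "'a topology"
  reg :: "'a set \<Rightarrow> ('a \<Rightarrow> complex) set"

definition sheaf_of_functions :: "'a fun_space \<Rightarrow> bool" where
  "sheaf_of_functions X \<longleftrightarrow>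
     (\<forall>U f g. openin (zar X) U \<longrightarrow> f \<in> reg X U \<longrightarrow> (\<forall>x\<in>U. f x = g x) \<longrightarrow> g \<in> reg X U) \<and>
     (\<forall>U W f. openin (zar X) U \<longrightarrow> openin (zar X) W \<longrightarrow> W \<subseteq> U \<longrightarrow> f \<in> reg X U \<longrightarrow> f \<in> reg X W) \<and>
     (\<forall>U f. openin (zar X) U \<longrightarrow>
        (\<forall>x\<in>U. \<exists>W. openin (zar X) W \<and> x \<in> W \<and> W \<subseteq> U \<and> f \<in> reg X W) \<longrightarrow> f \<in> reg X U)"

definition fs_morphism :: "'a fun_space \<Rightarrow> 'b fun_space \<Rightarrow> ('a \<Rightarrow> 'b) \<Rightarrow> bool" where
  "fs_morphism X Y h \<longleftrightarrow> continuous_map (zar X) (zar Y) h \<and>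
     (\<forall>U. openin (zar Y) U \<longrightarrow> (\<forall>f\<in>reg Y U. f \<circ> h \<in> reg X {x \<in> topspace (zar X). h x \<in> U}))"

definition fs_isomorphism :: "'a fun_space \<Rightarrow> 'b fun_space \<Rightarrow> ('a \<Rightarrow> 'b) \<Rightarrow> bool" where
  "fs_isomorphism X Y h \<longleftrightarrow>
     (\<exists>k. fs_morphism X Y h \<and> fs_morphism Y X k \<and>
       (\<forall>x\<in>topspace (zar X). k (h x) = x) \<and> (\<forall>y\<in>topspace (zar Y). h (k y) = y))"

definition open_subspace :: "'a fun_space \<Rightarrow> 'a set \<Rightarrow> 'a fun_space" where
  "open_subspace X U = \<lparr>zar = subtopology (zar X) U, reg = reg X\<rparr>"

text \<open>Regular functions on an algebraic set are locally quotients of polynomials; on a locally closed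
  subset of projective space they are locally quotients of forms of equal degree.\<close>

definition affine_fs :: "'v set \<Rightarrow> ('v \<Rightarrow> complex) set \<Rightarrow> ('v \<Rightarrow> complex) fun_space" where
  "affine_fs I V =
     \<lparr>zar = subtopology (affine_zariski I) V,
      reg = (\<lambda>U. {f. \<forall>x\<in>U. \<exists>W. openin (subtopology (affine_zariski I) V) W \<and> x \<in> W \<and> W \<subseteq> U \<and>
        (\<exists>g\<in>polys_in I. \<exists>h\<in>polys_in I.
           \<forall>y\<in>W. poly_eval h y \<noteq> 0 \<and> f y = poly_eval g y / poly_eval h y)})\<rparr>"

definition proj_fs :: "'v set \<Rightarrow> ('v \<Rightarrow> complex) set set \<Rightarrow> ('v \<Rightarrow> complex) set fun_space" where
  "proj_fs I V =
     \<lparr>zar = subtopology (proj_zariski I) V,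
      reg = (\<lambda>U. {f. \<forall>L\<in>U. \<exists>W. openin (subtopology (proj_zariski I) V) W \<and> L \<in> W \<and> W \<subseteq> U \<and>
        (\<exists>e. \<exists>g\<in>forms_in I e. \<exists>h\<in>forms_in I e.
           \<forall>M\<in>W. \<forall>y\<in>M. poly_eval h y \<noteq> 0 \<and> f M = poly_eval g y / poly_eval h y)})\<rparr>"

definition affine_chart ::
  "'a fun_space \<Rightarrow> 'a set \<Rightarrow> nat \<Rightarrow> (nat \<Rightarrow> complex) set \<Rightarrow> ('a \<Rightarrow> nat \<Rightarrow> complex) \<Rightarrow> bool" where
  "affine_chart X U m V h \<longleftrightarrow> openin (zar X) U \<and> algebraic_set {..<m} V \<and>
     fs_isomorphism (open_subspace X U) (affine_fs {..<m} V) h"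

text \<open>The diagonal of \<open>X \<times> X\<close> is closed. The product variety is covered by the products of affine
  charts of \<open>X\<close>, so this is the requirement that for any two charts \<open>h : U \<rightarrow> V\<close> and
  \<open>h' : U' \<rightarrow> V'\<close> the image of the diagonal is Zariski closed in \<open>V \<times> V'\<close>, which is a closed
  subset of affine \<open>(m + m')\<close>-space (here with coordinates indexed by a disjoint sum).\<close>

definition separated :: "'a fun_space \<Rightarrow> bool" where
  "separated X \<longleftrightarrow> (\<forall>U m V h U' m' V' h'. affine_chart X U m V h \<longrightarrow> affine_chart X U' m' V' h' \<longrightarrow>
     algebraic_set ({..<m} <+> {..<m'}) {case_sum (h x) (h' x) |x. x \<in> U \<inter> U'})"

definition complex_variety :: "'a fun_space \<Rightarrow> bool" where
  "complex_variety X \<longleftrightarrow> sheaf_of_functions X \<and>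
     (\<exists>\<U>. finite \<U> \<and> \<Union>\<U> = topspace (zar X) \<and> (\<forall>U\<in>\<U>. \<exists>m V h. affine_chart X U m V h)) \<and>
     separated X"

definition irreducible_space :: "'a topology \<Rightarrow> bool" where
  "irreducible_space X \<longleftrightarrow> topspace X \<noteq> {} \<and>
     (\<forall>A B. closedin X A \<longrightarrow> closedin X B \<longrightarrow> A \<union> B = topspace X \<longrightarrow> A = topspace X \<or> B = topspace X)"


section \<open>Endomorphisms of projective space\<close>

definition monoms :: "nat \<Rightarrow> nat \<Rightarrow> nat monom set" where
  "monoms n d = {J. Poly_Mapping.keys J \<subseteq> {..n} \<and> monom_degree J = d}"

lemma finite_monoms: "finite (monoms n d)"
proof -
  let ?F = "{f. \<forall>i. (i \<in> {..n} \<longrightarrow> f i \<in> {..d}) \<and> (i \<notin> {..n} \<longrightarrow> f i = (0::nat))}"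
  have "Poly_Mapping.lookup ` monoms n d \<subseteq> ?F"
  proof clarify
    fix J i assume J: "J \<in> monoms n d"
    have "Poly_Mapping.lookup J i \<le> d" if "i \<le> n"
    proof -
      have "Poly_Mapping.lookup J i \<le> (\<Sum>i\<in>{..n}. Poly_Mapping.lookup J i)"
        using that by (intro member_le_sum) auto
      then show ?thesis
        using J monom_degree_superset[of "{..n}" J] by (auto simp: monoms_def)
    qed
    then show "(i \<in> {..n} \<longrightarrow> Poly_Mapping.lookup J i \<in> {..d}) \<and>
        (i \<notin> {..n} \<longrightarrow> Poly_Mapping.lookup J i = 0)"
      using J by (auto simp: monoms_def in_keys_iff)
  qed
  then have "finite (Poly_Mapping.lookup ` monoms n d)"
    by (rule finite_subset) (rule finite_set_of_finite_funs; simp)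
  then show ?thesis
    by (rule finite_imageD) (auto intro: inj_onI poly_mapping_eqI)
qed

text \<open>\<open>a (i, J)\<close> is the coefficient of the monomial \<open>J\<close> in the \<open>i\<close>-th form, for \<open>i \<le> n\<close>.\<close>

definition coeff_index :: "nat \<Rightarrow> nat \<Rightarrow> (nat \<times> nat monom) set" where
  "coeff_index n d = {..n} \<times> monoms n d"

definition eval_forms ::
  "nat \<Rightarrow> nat \<Rightarrow> (nat \<times> nat monom \<Rightarrow> complex) \<Rightarrow> (nat \<Rightarrow> complex) \<Rightarrow> nat \<Rightarrow> complex" where
  "eval_forms n d a x = (\<lambda>i. if i \<le> n then \<Sum>J\<in>monoms n d. a (i, J) * monom_eval J x else 0)"

text \<open>The resultant of \<open>n + 1\<close> forms in \<open>n + 1\<close> variables vanishes exactly if the forms have a common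
  nontrivial zero.\<close>

definition Mor :: "nat \<Rightarrow> nat \<Rightarrow> (nat \<times> nat monom \<Rightarrow> complex) set set" where
  "Mor n d = {\<phi> \<in> proj_space (coeff_index n d).
     \<forall>a\<in>\<phi>. \<forall>x\<in>affine_space {..n}. eval_forms n d a x = (\<lambda>_. 0) \<longrightarrow> x = (\<lambda>_. 0)}"

definition Mor_fs :: "nat \<Rightarrow> nat \<Rightarrow> (nat \<times> nat monom \<Rightarrow> complex) set fun_space" where
  "Mor_fs n d = proj_fs (coeff_index n d) (Mor n d)"

text \<open>The self-map of projective space given by a point of \<open>Mor n d\<close>. Changing the representative of
  \<open>\<phi>\<close> or of \<open>P\<close> multiplies the value by a nonzero scalar, and the values for all representatives
  together form one point of projective space.\<close>

definition endo :: "nat \<Rightarrow> nat \<Rightarrow> (nat \<times> nat monom \<Rightarrow> complex) set \<Rightarrow>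
    (nat \<Rightarrow> complex) set \<Rightarrow> (nat \<Rightarrow> complex) set" where
  "endo n d \<phi> P = {eval_forms n d a x |a x. a \<in> \<phi> \<and> x \<in> P}"

lemma endo_proj_point:
  assumes "\<phi> \<in> Mor n d" "a \<in> \<phi>" "P \<in> proj_space {..n}" "x \<in> P"
  shows "endo n d \<phi> P = proj_point (eval_forms n d a x)" "endo n d \<phi> P \<in> proj_space {..n}"
proof -
  have phi: "\<phi> = proj_point a"
    using assms proj_space_rep(3) by (auto simp: Mor_def)
  have P: "P = proj_point x"
    using assms proj_space_rep(3) by blast
  have scale: "eval_forms n d (\<lambda>j. c * a j) (\<lambda>i. b * x i) = (\<lambda>i. (c * b ^ d) * eval_forms n d a x i)"
    for c b
    by (auto simp: eval_forms_def fun_eq_iff monom_eval_scale monoms_def sum_distrib_left mult_ac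
        intro!: sum.cong)
  show eq: "endo n d \<phi> P = proj_point (eval_forms n d a x)"
  proof (intro subset_antisym subsetI)
    fix y assume "y \<in> endo n d \<phi> P"
    then show "y \<in> proj_point (eval_forms n d a x)"
      unfolding endo_def phi P proj_point_def using scale by force
  next
    fix y assume "y \<in> proj_point (eval_forms n d a x)"
    then obtain c where "c \<noteq> 0" "y = (\<lambda>i. c * eval_forms n d a x i)"
      by (auto simp: proj_point_def)
    then have "y = eval_forms n d (\<lambda>j. c * a j) (\<lambda>i. 1 * x i)" "(\<lambda>j. c * a j) \<in> \<phi>" "(\<lambda>i. 1 * x i) \<in> P"
      using scale[of c 1] assms(4) by (auto simp: phi proj_point_def)
    then show "y \<in> endo n d \<phi> P"
      unfolding endo_def by blast
  qed
  have "x \<in> affine_space {..n}" "x \<noteq> (\<lambda>_. 0)"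
    using proj_space_rep[OF assms(3,4)] by auto
  then have "eval_forms n d a x \<noteq> (\<lambda>_. 0)"
    using assms(1,2) by (auto simp: Mor_def)
  moreover have "eval_forms n d a x \<in> affine_space {..n}"
    by (auto simp: eval_forms_def affine_space_def)
  ultimately show "endo n d \<phi> P \<in> proj_space {..n}"
    unfolding eq proj_space_def by blast
qed

end

theory Submission
  imports
    "HOL-Complex_Analysis.Cauchy_Integral_Formula"
    "HOL-Computational_Algebra.Fundamental_Theorem_Algebra"
    Defs
begin

text \<open>Let \<open>F\<close> and \<open>G\<close> be lifts of \<open>\<phi>\<close> and of some \<open>\<psi>\<^sub>t\<close> to \<open>\<complex>\<^sup>n\<^sup>+\<^sup>1\<close>. The factor \<open>c\<close> in
  \<open>F \<circ> G = c (G \<circ> F)\<close> is bounded and holomorphic on every affine line missing the origin, hence constant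
  by Liouville's theorem, and after scaling \<open>G\<close> by \<open>\<lambda>\<close> with \<open>\<lambda>\<^sup>d\<^sup>-\<^sup>1 c = 1\<close> the two lifts commute. A commuting lift maps
  points with bounded \<open>F\<close>-orbit to points with bounded \<open>F\<close>-orbit. As \<open>F\<close> has degree \<open>d > 1\<close>, a small ball
  around the origin consists of such points, and all of them lie in a fixed large ball; so the values of
  \<open>\<lambda>G\<close> on the small ball are bounded independently of \<open>t\<close>. Hence
  \<open>G(w)\<^sub>i G(w\<^sub>0)\<^sub>j\<^sup>d\<^sup>-\<^sup>2 / c\<close>, which depends only on \<open>\<psi>\<^sub>t\<close>, is for small \<open>w\<close> and \<open>w\<^sub>0\<close> a bounded regular function of \<open>t\<close>. By the
  Nullstellensatz a bounded function \<open>f\<close> on an affine variety makes \<open>1 / (f - l)\<close> polynomial for uncountably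
  many \<open>l\<close>; these are linearly dependent, so \<open>f\<close> is algebraic over \<open>\<complex>\<close> and takes finitely many values.
  Finitely many \<open>w\<close> determine \<open>\<psi>\<^sub>t\<close>, so \<open>\<psi>\<close> takes finitely many values on a nonempty open
  subset of \<open>T\<close>, and irreducibility makes it constant.\<close>


section \<open>Bounded polynomials on algebraic sets\<close>

text \<open>For a ring acting on itself the submodules are the ideals, so
  \<open>ideal.subspace\<close> means ideal and \<open>ideal.span\<close> the ideal generated by a
  set. Here \<open>scale_scale\<close> is associativity oriented to the left, which would fight
  \<open>mult.assoc\<close> in the simplifier.\<close>

interpretation ideal: module "(*) :: 'a::comm_ring_1 \<Rightarrow> 'a \<Rightarrow> 'a"
  by unfold_locales (simp_all add: algebra_simps)

declare ideal.scale_scale [simp del]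

abbreviation cst :: "complex \<Rightarrow> 'v cpoly" where
  "cst \<equiv> Poly_Mapping.single 0"

definition indet :: "'v \<Rightarrow> 'v cpoly" where
  "indet i = Poly_Mapping.single (Poly_Mapping.single i 1) 1"

lemma poly_eval_cst [simp]: "poly_eval (cst c) x = c"
  by (simp add: poly_eval_single monom_eval_def)

lemma poly_eval_indet [simp]: "poly_eval (indet i) x = x i"
  by (simp add: indet_def poly_eval_single monom_eval_def)

lemma poly_eval_minus: "poly_eval (- p) x = - poly_eval p x"
  by (simp add: poly_eval_def sum_negf)

lemma poly_eval_diff: "poly_eval (p - q) x = poly_eval p x - poly_eval q x"
  using poly_eval_add[of p "- q" x] by (simp add: poly_eval_minus)

lemma cst_mult: "cst (a * b) = cst a * cst b"
  by (simp add: mult_single)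

lemma cst_add: "cst (a + b) = cst a + cst b"
  by (simp add: single_add)

lemma cst_1: "cst 1 = 1"
  by simp

text \<open>The complex vector space structure, which gives meaning to linear dependence of
  polynomials over the constants.\<close>

interpretation cpoly: vector_space "\<lambda>c p. cst c * p :: 'v cpoly"
  by unfold_locales (simp_all only: distrib_left distrib_right cst_mult cst_add cst_1 mult.assoc mult_1)

text \<open>The ring homomorphism from C[X] that sends X to \<open>f\<close>. A nonzero
  \<open>p\<close> with \<open>poly_at f p\<close> in an ideal witnesses that \<open>f\<close> is
  algebraic over C modulo that ideal.\<close>

definition poly_at :: "'v cpoly \<Rightarrow> complex poly \<Rightarrow> 'v cpoly" where
  "poly_at f p = poly (map_poly cst p) f"

lemma poly_at_pCons: "poly_at f (pCons c p) = cst c + f * poly_at f p"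
  by (simp add: poly_at_def map_poly_pCons)

lemma poly_at_0 [simp]: "poly_at f 0 = 0"
  by (simp add: poly_at_def)

lemma poly_at_add: "poly_at f (p + q) = poly_at f p + poly_at f q"
  by (induction p q rule: poly_induct2) (simp_all add: poly_at_pCons single_add algebra_simps)

lemma poly_at_smult: "poly_at f (smult c p) = cst c * poly_at f p"
  by (induction p) (simp_all add: poly_at_pCons mult_single distrib_left mult.left_commute)

lemma poly_at_mult: "poly_at f (p * q) = poly_at f p * poly_at f q"
  by (induction p) (simp_all add: poly_at_pCons poly_at_add poly_at_smult algebra_simps)

lemma poly_at_sum: "poly_at f (sum p A) = (\<Sum>k\<in>A. poly_at f (p k))"
  by (induction A rule: infinite_finite_induct) (simp_all add: poly_at_add)

lemma poly_at_one [simp]: "poly_at f 1 = 1"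
  using poly_at_pCons[of f 1 0] by (simp add: one_pCons)

lemma poly_at_prod: "poly_at f (prod p A) = (\<Prod>k\<in>A. poly_at f (p k))"
  by (induction A rule: infinite_finite_induct) (simp_all add: poly_at_mult)

lemma poly_eval_poly_at: "poly_eval (poly_at f p) x = poly p (poly_eval f x)"
  by (induction p) (simp_all add: poly_at_pCons poly_eval_add poly_eval_mult)

lemma poly_at_linear: "poly_at f [:- c, 1:] = f - cst c"
  by (simp add: poly_at_pCons single_uminus)

text \<open>Serves at two levels: monomials are built from powers of single indeterminates,
  polynomials from terms.\<close>

lemma poly_mapping_add_induct [case_names single add]:
  fixes p :: "'a \<Rightarrow>\<^sub>0 'b::comm_monoid_add"
  assumes "\<And>k v. P (Poly_Mapping.single k v)" "\<And>p q. P p \<Longrightarrow> P q \<Longrightarrow> P (p + q)"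
  shows "P p"
proof -
  have "P (\<Sum>k\<in>A. Poly_Mapping.single k (Poly_Mapping.lookup p k))" for A
  proof (induction A rule: infinite_finite_induct)
    case (infinite A)
    then show ?case using assms(1)[of undefined 0] by simp
  next
    case empty
    then show ?case using assms(1)[of undefined 0] by simp
  qed (simp_all add: assms)
  moreover have "p = (\<Sum>k\<in>Poly_Mapping.keys p. Poly_Mapping.single k (Poly_Mapping.lookup p k))"
    by (rule poly_mapping_eqI) (auto simp: lookup_sum lookup_single when_def in_keys_iff)
  ultimately show ?thesis by metis
qed

text \<open>A monomial is determined by the graph of its nonzero exponents, a finite subset of a
  countable set.\<close>

lemma countable_monoms: "countable (UNIV :: 'v::countable monom set)"
proof -
  let ?g = "\<lambda>J :: 'v monom. (\<lambda>i. (i, Poly_Mapping.lookup J i)) ` Poly_Mapping.keys J"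
  have "inj ?g"
  proof (rule injI, rule poly_mapping_eqI)
    fix J K :: "'v monom" and i
    assume "?g J = ?g K"
    then have "(i, k) \<in> ?g J \<longleftrightarrow> (i, k) \<in> ?g K" for k by simp
    then have "k \<noteq> 0 \<and> k = Poly_Mapping.lookup J i \<longleftrightarrow> k \<noteq> 0 \<and> k = Poly_Mapping.lookup K i" for k
      by (auto simp: image_iff in_keys_iff)
    then show "Poly_Mapping.lookup J i = Poly_Mapping.lookup K i"
      by metis
  qed
  moreover have "range ?g \<subseteq> {A. finite A}" by auto
  moreover have "countable {A :: ('v \<times> nat) set. finite A}"
    by (rule countable_Collect_finite)
  ultimately show ?thesis
    by (meson countable_image_inj_on countable_subset)
qed

text \<open>Countably many monomials exhaust the polynomials by spans of finite sets
  \<open>B k\<close>. Uncountably many \<open>l\<close> have \<open>u l\<close> in one of these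
  spans, and more of them than its dimension are dependent.\<close>

lemma uncountable_family_dependent:
  fixes u :: "complex \<Rightarrow> 'v::countable cpoly"
  assumes "uncountable \<Lambda>"
  obtains L c l where "finite L" "L \<subseteq> \<Lambda>" "l \<in> L" "c l \<noteq> 0" "(\<Sum>l\<in>L. cst (c l) * u l) = 0"
proof -
  obtain e :: "nat \<Rightarrow> 'v monom" where e: "range e = UNIV"
    using countable_monoms uncountable_def by (metis UNIV_not_empty)
  define B where "B k = (\<lambda>i. Poly_Mapping.single (e i) 1 :: 'v cpoly) ` {..<k}" for k
  have "\<exists>k. p \<in> cpoly.span (B k)" for p
  proof -
    obtain i where i: "\<And>J. e (i J) = J"
      using e by (metis surj_def)
    define k where "k = Suc (Max (insert 0 (i ` Poly_Mapping.keys p)))"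
    have "i J < k" if "J \<in> Poly_Mapping.keys p" for J
      unfolding k_def using that by (simp add: le_imp_less_Suc)
    then have B: "Poly_Mapping.single J 1 \<in> B k" if "J \<in> Poly_Mapping.keys p" for J
      unfolding B_def using that i by (intro image_eqI[of _ _ "i J"]) auto
    have "p = (\<Sum>J\<in>Poly_Mapping.keys p. cst (Poly_Mapping.lookup p J) * Poly_Mapping.single J 1)"
      by (subst cpoly_expand) (simp add: mult_single)
    also have "\<dots> \<in> cpoly.span (B k)"
      by (intro cpoly.span_sum cpoly.span_scale cpoly.span_base B)
    finally show ?thesis by blast
  qed
  then have "\<Lambda> = (\<Union>k. {l \<in> \<Lambda>. u l \<in> cpoly.span (B k)})" by auto
  moreover have "countable (\<Union>k. {l \<in> \<Lambda>. u l \<in> cpoly.span (B k)})"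
    if "\<And>k. countable {l \<in> \<Lambda>. u l \<in> cpoly.span (B k)}"
    using that by (intro countable_UN) auto
  ultimately obtain k where "uncountable {l \<in> \<Lambda>. u l \<in> cpoly.span (B k)}"
    using assms by auto
  then have inf: "infinite {l \<in> \<Lambda>. u l \<in> cpoly.span (B k)}"
    using countable_finite by blast
  obtain L where L: "L \<subseteq> {l \<in> \<Lambda>. u l \<in> cpoly.span (B k)}" "finite L" "card L = Suc k"
    using infinite_arbitrarily_large[OF inf, of "Suc k"] by auto
  have "\<exists>c. (\<exists>l\<in>L. c l \<noteq> 0) \<and> (\<Sum>l\<in>L. cst (c l) * u l) = 0"
  \<comment> \<open>Dependence is a property of sets of vectors, so a coincidence
    \<open>u a = u b\<close> is treated apart; it gives the relation
    \<open>u a - u b = 0\<close>.\<close>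
  proof (cases "inj_on u L")
    case True
    have fB: "finite (B k)" and "card (B k) \<le> k"
      unfolding B_def using card_image_le[of "{..<k}"] by auto
    then have "card (u ` L) > card (B k)"
      using L(3) card_image[OF True] by simp
    moreover have "u ` L \<subseteq> cpoly.span (B k)" using L(1) by auto
    ultimately have "cpoly.dependent (u ` L)"
      using cpoly.independent_span_bound[OF fB, of "u ` L"] by auto
    then obtain v where "\<exists>p\<in>u ` L. v p \<noteq> 0" "(\<Sum>p\<in>u ` L. cst (v p) * p) = 0"
      using cpoly.dependent_finite[of "u ` L"] L(2) by auto
    then show ?thesis
      by (intro exI[of _ "v \<circ> u"]) (auto simp: sum.reindex[OF True])
  next
    case False
    then obtain a b where ab: "a \<in> L" "b \<in> L" "a \<noteq> b" "u a = u b"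
      by (auto simp: inj_on_def)
    have "(\<Sum>l\<in>L. cst (if l = a then 1 else if l = b then - 1 else 0) * u l) =
        (\<Sum>l\<in>{a, b}. cst (if l = a then 1 else if l = b then - 1 else 0) * u l)"
      by (rule sum.mono_neutral_right) (use ab L(2) in auto)
    also have "\<dots> = 0"
      using ab by (simp add: single_uminus)
    finally show ?thesis
      using ab by (intro exI[of _ "\<lambda>l. if l = a then 1 else if l = b then - 1 else 0"]) auto
  qed
  then show ?thesis
    using that[of L] L by auto
qed

text \<open>Modulo \<open>I\<close> the elements \<open>f - cst l\<close> have inverses; clearing
  denominators in a linear relation between these inverses gives a polynomial relation for
  \<open>f\<close>.\<close>

lemma algebraic_mod_ideal:
  fixes f :: "'v::countable cpoly"
  assumes I: "ideal.subspace I" and "uncountable \<Lambda>"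
    and inv: "\<And>l. l \<in> \<Lambda> \<Longrightarrow> \<exists>u. 1 - u * (f - cst l) \<in> I"
  obtains p where "p \<noteq> 0" "poly_at f p \<in> I"
proof -
  obtain u where u: "\<And>l. l \<in> \<Lambda> \<Longrightarrow> 1 - u l * (f - cst l) \<in> I"
    using inv by metis
  obtain L c l0 where L: "finite L" "L \<subseteq> \<Lambda>" "l0 \<in> L" "c l0 \<noteq> 0"
      and dep: "(\<Sum>l\<in>L. cst (c l) * u l) = 0"
    using uncountable_family_dependent[OF assms(2)] by metis
  define p where "p = (\<Sum>l\<in>L. smult (c l) (\<Prod>m\<in>L - {l}. [:- m, 1:]))"
  \<comment> \<open>At \<open>l0\<close> every other summand contains the factor
    \<open>l0 - l0\<close>, so \<open>p\<close> is not zero.\<close>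
  have "poly p l0 = (\<Sum>l\<in>L. c l * (\<Prod>m\<in>L - {l}. l0 - m))"
    by (simp add: p_def poly_sum poly_prod)
  also have "\<dots> = (\<Sum>l\<in>{l0}. c l * (\<Prod>m\<in>L - {l}. l0 - m))"
    by (rule sum.mono_neutral_right) (use L in auto)
  also have "\<dots> \<noteq> 0"
    using L by auto
  finally have "p \<noteq> 0" by auto
  define Q where "Q l = (\<Prod>m\<in>L - {l}. f - cst m)" for l
  have Q: "Q l * (f - cst l) = (\<Prod>m\<in>L. f - cst m)" if "l \<in> L" for l
    unfolding Q_def using L(1) that by (simp add: prod.remove mult.commute)
  \<comment> \<open>The product of all \<open>f - cst m\<close> factors out and its cofactor
    vanishes by \<open>dep\<close>. Hence \<open>poly_at f p\<close> is a combination of the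
    elements \<open>1 - u l * (f - cst l)\<close> of \<open>I\<close>, with coefficients
    \<open>cst (c l) * Q l\<close>.\<close>
  have "(\<Sum>l\<in>L. cst (c l) * Q l * (u l * (f - cst l))) = (\<Sum>l\<in>L. cst (c l) * u l) * (\<Prod>m\<in>L. f - cst m)"
    unfolding sum_distrib_right by (intro sum.cong) (simp_all add: Q[symmetric] mult_ac)
  then have "poly_at f p = (\<Sum>l\<in>L. cst (c l) * Q l * (1 - u l * (f - cst l)))"
    using dep by (simp add: p_def Q_def poly_at_sum poly_at_smult poly_at_prod poly_at_linear
        right_diff_distrib sum_subtractf)
  moreover have "\<dots> \<in> I"
    using u L(2) by (intro ideal.subspace_sum[OF I] ideal.subspace_scale[OF I]) auto
  ultimately show ?thesis
    using that \<open>p \<noteq> 0\<close> by metis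
qed

text \<open>Modulo a maximal ideal containing \<open>S\<close> every indeterminate is algebraic over
  C, because C is uncountable and the ring has countable dimension. As C is algebraically closed,
  each indeterminate is then congruent to a constant, and these constants are the coordinates of a
  common zero of \<open>S\<close>.\<close>

lemma weak_nullstellensatz:
  fixes S :: "'v::countable cpoly set"
  assumes "\<And>x. \<exists>p\<in>S. poly_eval p x \<noteq> 0"
  shows "1 \<in> ideal.span S"
proof (rule ccontr)
  assume "1 \<notin> ideal.span S"
  \<comment> \<open>Zorn's lemma is applied to the proper ideals containing \<open>S\<close>;
    properness is expressed by \<open>1 \<notin> I\<close>, which passes to unions of
    chains.\<close>
  define \<A> where "\<A> = {I. ideal.subspace I \<and> 1 \<notin> I \<and> S \<subseteq> I}"
  have "ideal.span S \<in> \<A>"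
    using \<open>1 \<notin> ideal.span S\<close> by (auto simp: \<A>_def intro: ideal.span_base)
  moreover have "\<Union>\<C> \<in> \<A>" if C: "\<C> \<noteq> {}" "subset.chain \<A> \<C>" for \<C>
  proof -
    have "x + y \<in> \<Union>\<C>" if xy: "x \<in> \<Union>\<C>" "y \<in> \<Union>\<C>" for x y
    proof -
      obtain A B where AB: "A \<in> \<C>" "B \<in> \<C>" "x \<in> A" "y \<in> B" using xy by blast
      have "A \<subseteq> B \<or> B \<subseteq> A" using C(2) AB unfolding subset_chain_def by blast
      moreover have "ideal.subspace A" "ideal.subspace B"
        using C(2) AB by (auto simp: \<A>_def subset_chain_def)
      ultimately show ?thesis using AB by (auto intro: ideal.subspace_add)
    qed
    moreover have mem: "ideal.subspace A" "1 \<notin> A" "S \<subseteq> A" if "A \<in> \<C>" for A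
      using C(2) that by (auto simp: \<A>_def subset_chain_def)
    moreover have "c * x \<in> \<Union>\<C>" if x: "x \<in> \<Union>\<C>" for c x
      using x mem(1) ideal.subspace_scale by blast
    moreover obtain A where A: "A \<in> \<C>" using C(1) by blast
    moreover have "0 \<in> \<Union>\<C>"
      using A ideal.subspace_0[OF mem(1)[OF A]] by blast
    moreover have "S \<subseteq> \<Union>\<C>" "1 \<notin> \<Union>\<C>"
      using A mem(2,3) by blast+
    ultimately show ?thesis
      unfolding \<A>_def mem_Collect_eq by (intro conjI ideal.subspaceI) assumption+
  qed
  ultimately obtain M where "M \<in> \<A>" and max: "\<And>X. X \<in> \<A> \<Longrightarrow> M \<subseteq> X \<Longrightarrow> X = M"
    using subset_Zorn_nonempty[of \<A>] by (metis empty_iff)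
  then have M: "ideal.subspace M" "1 \<notin> M" "S \<subseteq> M"
    by (auto simp: \<A>_def)
  \<comment> \<open>By maximality everything outside \<open>M\<close> is a unit modulo
    \<open>M\<close>.\<close>
  have inv: "\<exists>u. 1 - u * g \<in> M" if "g \<notin> M" for g
  proof -
    have "ideal.span (insert g M) \<notin> \<A>"
      using max[of "ideal.span (insert g M)"] that ideal.span_superset[of "insert g M"] by auto
    moreover have "S \<subseteq> ideal.span (insert g M)"
      using M(3) ideal.span_superset[of "insert g M"] by auto
    ultimately have "1 \<in> ideal.span (insert g M)"
      by (auto simp: \<A>_def)
    then show ?thesis
      by (auto simp: ideal.span_insert ideal.span_eq_iff[THEN iffD2, OF M(1)])
  qed
  \<comment> \<open>Otherwise all \<open>indet i - cst l\<close> are units modulo \<open>M\<close>,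
    so the indeterminate is algebraic. A relation \<open>p\<close> of least degree has a root
    \<open>r\<close>, and cancelling the unit \<open>indet i - cst r\<close> leaves a relation of
    smaller degree.\<close>
  have "\<exists>l. indet i - cst l \<in> M" for i
  proof (rule ccontr)
    assume no: "\<nexists>l. indet i - cst l \<in> M"
    then have "\<exists>u. 1 - u * (indet i - cst l) \<in> M" for l
      using inv by blast
    then obtain p0 where "p0 \<noteq> 0" "poly_at (indet i) p0 \<in> M"
      using algebraic_mod_ideal[OF M(1) uncountable_UNIV_complex] by metis
    then obtain p where p: "p \<noteq> 0" "poly_at (indet i) p \<in> M"
      and min: "\<And>q. q \<noteq> 0 \<Longrightarrow> poly_at (indet i) q \<in> M \<Longrightarrow> degree p \<le> degree q"
      using exists_least_iff[of "\<lambda>k. \<exists>p. p \<noteq> 0 \<and> poly_at (indet i) p \<in> M \<and> degree p = k"]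
      by (metis not_less)
    show False
    proof (cases "degree p = 0")
      case True
      then obtain c where c: "p = [:c:]" "c \<noteq> 0"
        using p(1) by (metis degree_eq_zeroE pCons_0_0)
      then have "cst (inverse c) * poly_at (indet i) p = 1"
        by (simp add: poly_at_pCons mult_single)
      then show False
        using M(2) ideal.subspace_scale[OF M(1) p(2), of "cst (inverse c)"] by simp
    next
      case False
      then obtain r where "poly p r = 0"
        using fundamental_theorem_of_algebra[of p] by (metis constant_degree)
      then obtain q where q: "p = [:- r, 1:] * q"
        by (metis dvdE poly_eq_0_iff_dvd)
      then have "q \<noteq> 0" using p(1) by auto
      then have dq: "degree q < degree p"
        unfolding q by (subst degree_mult_eq) auto
      obtain u where u: "1 - u * (indet i - cst r) \<in> M"
        using inv no by blast
      have "poly_at (indet i) q =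
          poly_at (indet i) q * (1 - u * (indet i - cst r)) + u * poly_at (indet i) p"
        by (simp only: q poly_at_mult poly_at_linear) (simp add: algebra_simps)
      moreover have "\<dots> \<in> M"
        using u p(2) by (intro ideal.subspace_add[OF M(1)] ideal.subspace_scale[OF M(1)])
      ultimately show False
        using min[OF \<open>q \<noteq> 0\<close>] dq by (metis not_less)
    qed
  qed
  then obtain x where x: "\<And>i. indet i - cst (x i) \<in> M" by metis
  \<comment> \<open>Reduction modulo \<open>M\<close> is evaluation at \<open>x\<close>: the
    polynomials congruent to their value at \<open>x\<close> include the constants and the
    indeterminates and are closed under sums and products.\<close>
  have ev_mult: "p * q - cst (poly_eval (p * q) x) \<in> M"
    if "p - cst (poly_eval p x) \<in> M" "q - cst (poly_eval q x) \<in> M" for p q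
  proof -
    have "p * q - cst (poly_eval (p * q) x) =
        q * (p - cst (poly_eval p x)) + cst (poly_eval p x) * (q - cst (poly_eval q x))"
      by (simp only: poly_eval_mult cst_mult) (simp add: algebra_simps)
    then show ?thesis
      using that by (simp only: ideal.subspace_add[OF M(1)] ideal.subspace_scale[OF M(1)])
  qed
  have ev_add: "p + q - cst (poly_eval (p + q) x) \<in> M"
    if "p - cst (poly_eval p x) \<in> M" "q - cst (poly_eval q x) \<in> M" for p q
  proof -
    have "p + q - cst (poly_eval (p + q) x) =
        (p - cst (poly_eval p x)) + (q - cst (poly_eval q x))"
      by (simp only: poly_eval_add cst_add) (simp add: algebra_simps)
    then show ?thesis
      using ideal.subspace_add[OF M(1) that] by (simp only:)
  qed
  have ev_cst: "cst c - cst (poly_eval (cst c) x) \<in> M" for c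
    using ideal.subspace_0[OF M(1)] by simp
  have ev_pow: "indet i ^ k - cst (poly_eval (indet i ^ k) x) \<in> M" for i k
  proof (induction k)
    case 0
    then show ?case using ev_cst[of 1] by (simp add: cst_1)
  next
    case (Suc k)
    then show ?case using ev_mult[of "indet i" "indet i ^ k"] x[of i] by simp
  qed
  have pow: "indet i ^ k = Poly_Mapping.single (Poly_Mapping.single i k) (1::complex)" for i :: 'v and k
    by (induction k) (simp_all add: indet_def mult_single single_add[symmetric])
  have ev_monom: "Poly_Mapping.single J 1 - cst (poly_eval (Poly_Mapping.single J 1) x) \<in> M"
    for J :: "'v monom"
  proof (induction J rule: poly_mapping_add_induct)
    case (single i k)
    then show ?case using ev_pow[of i k] unfolding pow .
  next
    case (add J K)
    have "Poly_Mapping.single (J + K) (1::complex) = Poly_Mapping.single J 1 * Poly_Mapping.single K 1"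
      by (simp add: mult_single)
    then show ?case using ev_mult[OF add] by (simp only:)
  qed
  have "p - cst (poly_eval p x) \<in> M" for p
  proof (induction p rule: poly_mapping_add_induct)
    case (single J c)
    have "Poly_Mapping.single J c = cst c * Poly_Mapping.single J 1"
      by (simp add: mult_single)
    then show ?case using ev_mult[OF ev_cst ev_monom, of c J] by (simp only:)
  next
    case (add p q)
    then show ?case using ev_add by blast
  qed
  note ev = this
  obtain p where p: "p \<in> S" "poly_eval p x \<noteq> 0" using assms by blast
  \<comment> \<open>Both \<open>p\<close> and \<open>p - cst (poly_eval p x)\<close> lie in
    \<open>M\<close>, hence so does the nonzero constant \<open>cst (poly_eval p x)\<close>, a
    unit.\<close>
  have "cst (inverse (poly_eval p x)) * (p - (p - cst (poly_eval p x))) = 1"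
    using p(2) by (simp add: mult_single)
  moreover have "cst (inverse (poly_eval p x)) * (p - (p - cst (poly_eval p x))) \<in> M"
    by (intro ideal.subspace_scale[OF M(1)] ideal.subspace_diff[OF M(1)] ev subsetD[OF M(3)] p(1))
  ultimately show False using M(2) by simp
qed

text \<open>A number \<open>l\<close> of modulus above \<open>B\<close> is not a value of
  \<open>f\<close> on the zero set, so by the Nullstellensatz \<open>f - cst l\<close> is a unit
  modulo the ideal generated by \<open>S\<close>. Then \<open>f\<close> is algebraic modulo that
  ideal, and its values on the zero set are roots of one polynomial.\<close>

lemma bounded_poly_finite_range:
  fixes f :: "'v::countable cpoly"
  assumes bd: "\<And>x. \<forall>p\<in>S. poly_eval p x = 0 \<Longrightarrow> norm (poly_eval f x) \<le> B"
  shows "finite (poly_eval f ` {x. \<forall>p\<in>S. poly_eval p x = 0})"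
proof -
  \<comment> \<open>A half-plane: uncountable, with all elements of modulus above
    \<open>B\<close>.\<close>
  let ?\<Lambda> = "{z. Im z > B}"
  have "\<exists>u. 1 - u * (f - cst l) \<in> ideal.span S" if "l \<in> ?\<Lambda>" for l
  proof -
    have "\<exists>p\<in>insert (f - cst l) S. poly_eval p x \<noteq> 0" for x
    proof (cases "\<forall>p\<in>S. poly_eval p x = 0")
      case True
      then have "norm (poly_eval f x) < norm l"
        using bd[of x] that abs_Im_le_cmod[of l] by auto
      then show ?thesis by (auto simp: poly_eval_diff)
    qed auto
    then have "1 \<in> ideal.span (insert (f - cst l) S)"
      by (rule weak_nullstellensatz)
    then show ?thesis
      by (simp add: ideal.span_insert)
  qed
  then obtain p where p: "p \<noteq> 0" "poly_at f p \<in> ideal.span S"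
    using algebraic_mod_ideal[OF ideal.subspace_span uncountable_halfspace_Im_gt] by (metis (mono_tags))
  have "poly p (poly_eval f x) = 0" if x: "\<forall>p\<in>S. poly_eval p x = 0" for x
  proof -
    have "ideal.span S \<subseteq> {q. poly_eval q x = 0}"
      by (rule ideal.span_minimal)
        (use x in \<open>auto simp: ideal.subspace_def poly_eval_add poly_eval_mult\<close>)
    then show ?thesis using p(2) by (auto simp: poly_eval_poly_at)
  qed
  then have "poly_eval f ` {x. \<forall>p\<in>S. poly_eval p x = 0} \<subseteq> {z. poly p z = 0}" by auto
  then show ?thesis
    using poly_roots_finite[OF p(1)] finite_subset by blast
qed


section \<open>Bounded regular functions on varieties\<close>

lemma poly_eval_cong:
  assumes "p \<in> polys_in I" "\<And>i. i \<in> I \<Longrightarrow> x i = y i"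
  shows "poly_eval p x = poly_eval p y"
proof -
  have "monom_eval J x = monom_eval J y" if J: "J \<in> Poly_Mapping.keys p" for J
    unfolding monom_eval_def
  proof (rule prod.cong)
    fix i assume "i \<in> Poly_Mapping.keys J"
    then have "i \<in> I" using J assms(1) by (auto simp: polys_in_def)
    then show "x i ^ Poly_Mapping.lookup J i = y i ^ Poly_Mapping.lookup J i"
      by (simp add: assms(2))
  qed simp
  then show ?thesis by (simp add: poly_eval_def)
qed

text \<open>Near \<open>x0\<close> the function is a single quotient of polynomials, and on a
  principal open neighbourhood the claim reduces to that for bounded polynomials.\<close>

lemma affine_regular_bounded_locally_finite:
  fixes V :: "(nat \<Rightarrow> complex) set"
  assumes V: "algebraic_set {..<m} V" and f: "f \<in> reg (affine_fs {..<m} V) O'"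
    and x0: "x0 \<in> O'" and bd: "\<And>y. y \<in> O' \<Longrightarrow> norm (f y) \<le> B"
  shows "\<exists>W. openin (zar (affine_fs {..<m} V)) W \<and> x0 \<in> W \<and> W \<subseteq> O' \<and> finite (f ` W)"
proof -
  let ?A = "affine_space {..<m}"
  obtain W1 g h where W1: "openin (subtopology (affine_zariski {..<m}) V) W1" "x0 \<in> W1" "W1 \<subseteq> O'"
      and gh: "g \<in> polys_in {..<m}" "h \<in> polys_in {..<m}"
        "\<And>y. y \<in> W1 \<Longrightarrow> poly_eval h y \<noteq> 0 \<and> f y = poly_eval g y / poly_eval h y"
    using f x0 by (fastforce simp: affine_fs_def)
  obtain W2 where W2: "openin (affine_zariski {..<m}) W2" "W1 = W2 \<inter> V"
    using W1(1) by (auto simp: openin_subtopology)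
  obtain S where S: "S \<subseteq> polys_in {..<m}" "?A - W2 = affine_zeros {..<m} S" "W2 \<subseteq> ?A"
    using W2(1) by (auto simp: openin_affine_zariski algebraic_set_def)
  have "x0 \<in> ?A" "x0 \<notin> affine_zeros {..<m} S"
    using W1(2) W2(2) S(2,3) by auto
  \<comment> \<open>A polynomial \<open>s\<close> that vanishes off \<open>W2\<close> but not at
    \<open>x0\<close> cuts out a principal open neighbourhood inside \<open>W1\<close>.\<close>
  then obtain s where s: "s \<in> S" "poly_eval s x0 \<noteq> 0"
    by (auto simp: affine_zeros_def)
  have sp: "s \<in> polys_in {..<m}" using s(1) S(1) by auto
  obtain SV where SV: "SV \<subseteq> polys_in {..<m}" "V = affine_zeros {..<m} SV"
    using V by (auto simp: algebraic_set_def)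
  define W where "W = {y \<in> ?A. poly_eval s y \<noteq> 0} \<inter> V"
  have "?A - {y \<in> ?A. poly_eval s y \<noteq> 0} = affine_zeros {..<m} {s}"
    by (auto simp: affine_zeros_def)
  then have "openin (affine_zariski {..<m}) {y \<in> ?A. poly_eval s y \<noteq> 0}"
    using sp unfolding openin_affine_zariski algebraic_set_def by blast
  then have Wopen: "openin (zar (affine_fs {..<m} V)) W"
    unfolding W_def by (simp add: affine_fs_def openin_subtopology_Int)
  have "y \<in> W1" if "y \<in> W" for y
  proof -
    have "y \<notin> ?A - W2" using that s(1) unfolding S(2) by (auto simp: W_def affine_zeros_def)
    then show ?thesis using that W2(2) by (auto simp: W_def)
  qed
  then have WW1: "W \<subseteq> W1" by blast
  have x0W: "x0 \<in> W"
    using \<open>x0 \<in> ?A\<close> s(2) W1(2) W2(2) by (simp add: W_def)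
  text \<open>Rabinowitsch: the principal open set \<open>W\<close> is an algebraic set with one more coordinate,
    and there \<open>f\<close> becomes a polynomial.\<close>
  let ?Z = "{z. \<forall>p\<in>insert (indet m * s * h - 1) SV. poly_eval p z = 0}"
  let ?f = "g * indet m * s"
  have Z: "\<exists>y\<in>W. poly_eval ?f z = f y" if z: "z \<in> ?Z" for z
  proof -
    \<comment> \<open>Points of \<open>?Z\<close> are arbitrary functions; their coordinates from
      \<open>m\<close> on are replaced by 0 to obtain a point of the affine space.\<close>
    define y where "y = (\<lambda>i. if i < m then z i else 0)"
    have ev: "poly_eval p y = poly_eval p z" if "p \<in> polys_in {..<m}" for p
      by (rule poly_eval_cong[OF that]) (simp add: y_def)
    have yA: "y \<in> ?A" by (simp add: y_def affine_space_def)
    have "y \<in> V"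
      using z SV(1) ev yA unfolding SV(2) affine_zeros_def by auto
    have eq: "z m * poly_eval s y * poly_eval h y = 1"
      using z by (simp add: poly_eval_diff poly_eval_mult ev sp gh)
    then have "poly_eval s y \<noteq> 0" "poly_eval h y \<noteq> 0" by auto
    then have "y \<in> W" using yA \<open>y \<in> V\<close> by (simp add: W_def)
    have "f y = poly_eval g y / poly_eval h y"
      using gh(3) WW1 \<open>y \<in> W\<close> by blast
    also have "\<dots> = poly_eval g y * (z m * poly_eval s y * poly_eval h y) / poly_eval h y"
      by (simp add: eq)
    also have "\<dots> = poly_eval ?f z"
      using \<open>poly_eval h y \<noteq> 0\<close> by (simp add: poly_eval_mult ev sp gh mult_ac)
    finally show ?thesis using \<open>y \<in> W\<close> by metis
  qed
  have "norm (poly_eval ?f z) \<le> B"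
    if z: "\<forall>p\<in>insert (indet m * s * h - 1) SV. poly_eval p z = 0" for z
  proof -
    obtain y where "y \<in> W" "poly_eval ?f z = f y"
      using Z[of z] z by blast
    then show ?thesis
      using bd WW1 W1(3) by auto
  qed
  note fin = bounded_poly_finite_range[of "insert (indet m * s * h - 1) SV" ?f B, OF this]
  have "f ` W \<subseteq> poly_eval ?f ` ?Z"
  proof clarify
    fix y assume y: "y \<in> W"
    \<comment> \<open>The extra coordinate inverts \<open>s * h\<close>, so
      \<open>g * indet m * s\<close> takes the value of \<open>g / h\<close>.\<close>
    define z where "z = y(m := 1 / (poly_eval s y * poly_eval h y))"
    have ev: "poly_eval p z = poly_eval p y" if "p \<in> polys_in {..<m}" for p
      by (rule poly_eval_cong[OF that]) (simp add: z_def)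
    have nz: "poly_eval s y \<noteq> 0" "poly_eval h y \<noteq> 0" "f y = poly_eval g y / poly_eval h y"
      using y WW1 gh(3) by (auto simp: W_def)
    have "\<forall>p\<in>SV. poly_eval p z = 0"
      using y SV(1) ev unfolding W_def SV(2) affine_zeros_def by auto
    moreover have "poly_eval (indet m * s * h - 1) z = 0"
      using nz by (simp add: poly_eval_diff poly_eval_mult ev sp gh) (simp add: z_def)
    ultimately have zZ: "z \<in> ?Z" by simp
    have "f y = poly_eval ?f z"
      using nz by (simp add: poly_eval_mult ev sp gh) (simp add: z_def)
    then show "f y \<in> poly_eval ?f ` ?Z" using zZ by (rule image_eqI)
  qed
  from finite_subset[OF this fin] have "finite (f ` W)" .
  then show ?thesis using Wopen x0W WW1 W1(3) by blast
qed

text \<open>The claim is local, so an affine chart \<open>h\<close> around \<open>t0\<close> with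
  inverse \<open>k\<close> transports it from the affine case; \<open>f \<circ> k\<close> is regular
  because \<open>k\<close> is a morphism.\<close>

lemma variety_regular_bounded_locally_finite:
  assumes T: "complex_variety T" and O: "openin (zar T) O'" and f: "f \<in> reg T O'"
    and t0: "t0 \<in> O'" and bd: "\<And>t. t \<in> O' \<Longrightarrow> norm (f t) \<le> B"
  shows "\<exists>W. openin (zar T) W \<and> t0 \<in> W \<and> W \<subseteq> O' \<and> finite (f ` W)"
proof -
  have "t0 \<in> topspace (zar T)" using O t0 openin_subset by blast
  then obtain U m V h where "t0 \<in> U" and U: "affine_chart T U m V h"
    using T unfolding complex_variety_def by blast
  then have openU: "openin (zar T) U" and V: "algebraic_set {..<m} V"
    by (auto simp: affine_chart_def)
  let ?A = "affine_fs {..<m} V" and ?U = "open_subspace T U"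
  obtain k where h: "fs_morphism ?U ?A h" and k: "fs_morphism ?A ?U k"
      and kh: "\<And>t. t \<in> topspace (zar ?U) \<Longrightarrow> k (h t) = t"
    using U by (auto simp: affine_chart_def fs_isomorphism_def)
  have topU: "topspace (zar ?U) = U"
    using openin_subset[OF openU] by (auto simp: open_subspace_def)
  have "f \<in> reg T (O' \<inter> U)"
    using T f O openU unfolding complex_variety_def sheaf_of_functions_def
    by (meson inf_le1 openin_Int)
  moreover have openOU: "openin (zar ?U) (O' \<inter> U)"
    using O by (auto simp: open_subspace_def openin_subtopology)
  ultimately have fk: "f \<circ> k \<in> reg ?A {x \<in> topspace (zar ?A). k x \<in> O' \<inter> U}"
    using k by (auto simp: fs_morphism_def open_subspace_def)
  have "h t0 \<in> topspace (zar ?A)"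
    using h \<open>t0 \<in> U\<close> topU by (auto simp: fs_morphism_def dest!: continuous_map_funspace)
  then have "h t0 \<in> {x \<in> topspace (zar ?A). k x \<in> O' \<inter> U}"
    using kh topU \<open>t0 \<in> U\<close> t0 by simp
  then obtain W where W: "openin (zar ?A) W" "h t0 \<in> W" "W \<subseteq> {x \<in> topspace (zar ?A). k x \<in> O' \<inter> U}"
      "finite ((f \<circ> k) ` W)"
    using affine_regular_bounded_locally_finite[OF V fk, of "h t0" B] bd by auto
  let ?W = "{t \<in> topspace (zar ?U). h t \<in> W}"
  have "openin (zar ?U) ?W"
    using h W(1) by (auto simp: fs_morphism_def intro: openin_continuous_map_preimage)
  then have "openin (zar T) ?W"
    using openU by (auto simp: open_subspace_def dest: openin_trans_full)
  moreover have "t0 \<in> ?W" using \<open>t0 \<in> U\<close> topU W(2) by simp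
  moreover have "?W \<subseteq> O'"
  proof
    fix t assume "t \<in> ?W"
    then have "k (h t) = t" "k (h t) \<in> O'" using kh W(3) by auto
    then show "t \<in> O'" by simp
  qed
  moreover have "f ` ?W \<subseteq> (f \<circ> k) ` W"
  proof clarify
    fix t assume "t \<in> topspace (zar ?U)" "h t \<in> W"
    then show "f t \<in> (f \<circ> k) ` W"
      using kh by (intro image_eqI[of _ _ "h t"]) auto
  qed
  then have "finite (f ` ?W)" using W(4) finite_subset by blast
  ultimately show ?thesis by blast
qed

section \<open>Irreducible spaces\<close>

lemma irreducible_finite_closed_cover:
  assumes "irreducible_space X" "finite \<C>" "\<And>C. C \<in> \<C> \<Longrightarrow> closedin X C" "\<Union>\<C> = topspace X"
  shows "topspace X \<in> \<C>"
  using assms(2-4)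
proof (induction \<C> rule: finite_induct)
  case empty
  then show ?case using assms(1) by (simp add: irreducible_space_def)
next
  case (insert C \<C>)
  have "closedin X C" "closedin X (\<Union>\<C>)"
    using insert by (auto intro: closedin_Union)
  moreover have "C \<union> \<Union>\<C> = topspace X" using insert by simp
  ultimately have "C = topspace X \<or> \<Union>\<C> = topspace X"
    using assms(1) unfolding irreducible_space_def by blast
  then show ?case using insert by auto
qed

text \<open>The space is the union of the complement of \<open>W\<close> and the finitely many
  closed fibres that meet \<open>W\<close>. The complement is proper, so by irreducibility one fibre
  is everything.\<close>

lemma irreducible_constant:
  assumes X: "irreducible_space X" and h: "continuous_map X Y h"
    and W: "openin X W" "W \<noteq> {}" "finite (h ` W)" and pts: "\<And>y. y \<in> h ` W \<Longrightarrow> closedin Y {y}"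
    and st: "s \<in> topspace X" "t \<in> topspace X"
  shows "h s = h t"
proof -
  let ?\<C> = "insert (topspace X - W) ((\<lambda>y. {x \<in> topspace X. h x \<in> {y}}) ` h ` W)"
  have "topspace X \<in> ?\<C>"
  proof (rule irreducible_finite_closed_cover[OF X])
    show "closedin X C" if "C \<in> ?\<C>" for C
    proof -
      have "closedin X (topspace X - W)" using W(1) by blast
      moreover have "closedin X {x \<in> topspace X. h x \<in> {y}}" if "y \<in> h ` W" for y
        by (rule closedin_continuous_map_preimage[OF h pts[OF that]])
      ultimately show ?thesis using that by blast
    qed
    show "\<Union>?\<C> = topspace X" using openin_subset[OF W(1)] by auto
  qed (use W in auto)
  moreover have "topspace X \<noteq> topspace X - W"
    using W openin_subset[OF W(1)] by auto
  ultimately obtain y where y: "topspace X = {x \<in> topspace X. h x \<in> {y}}"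
    by blast
  have "s \<in> {x \<in> topspace X. h x \<in> {y}}" "t \<in> {x \<in> topspace X. h x \<in> {y}}"
    using st y by blast+
  then show ?thesis by simp
qed


section \<open>Lifts of commuting endomorphisms\<close>

lemma eval_forms_in_affine_space [simp]: "eval_forms n d a x \<in> affine_space {..n}"
  by (simp add: eval_forms_def affine_space_def)

lemma eval_forms_scale: "eval_forms n d a (\<lambda>i. c * x i) = (\<lambda>i. c ^ d * eval_forms n d a x i)"
  by (auto simp: eval_forms_def fun_eq_iff monom_eval_scale monoms_def sum_distrib_left mult_ac
      intro!: sum.cong)

lemma eval_forms_coeff_scale:
  "eval_forms n d (\<lambda>j. c * a j) x = (\<lambda>i. c * eval_forms n d a x i)"
  by (auto simp: eval_forms_def fun_eq_iff sum_distrib_left mult_ac)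

lemma affine_space_scale: "x \<in> affine_space I \<Longrightarrow> (\<lambda>i. c * x i) \<in> affine_space I"
  by (simp add: affine_space_def)

text \<open>A norm on \<open>affine_space {..n}\<close>, where entries beyond \<open>n\<close>
  vanish; on all functions only a seminorm.\<close>

definition vnorm :: "nat \<Rightarrow> (nat \<Rightarrow> complex) \<Rightarrow> real" where
  "vnorm n x = (\<Sum>i\<le>n. norm (x i))"

lemma vnorm_nonneg [simp]: "vnorm n x \<ge> 0"
  by (simp add: vnorm_def sum_nonneg)

lemma vnorm_scale: "vnorm n (\<lambda>i. c * x i) = norm c * vnorm n x"
  by (simp add: vnorm_def norm_mult sum_distrib_left)

lemma vnorm_eq_0_iff: "x \<in> affine_space {..n} \<Longrightarrow> vnorm n x = 0 \<longleftrightarrow> x = (\<lambda>_. 0)"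
  by (auto simp: vnorm_def affine_space_def sum_nonneg_eq_0_iff fun_eq_iff)

lemma norm_le_vnorm: "x \<in> affine_space {..n} \<Longrightarrow> norm (x i) \<le> vnorm n x"
proof (cases "i \<le> n")
  case True
  then show ?thesis
    unfolding vnorm_def by (intro member_le_sum[of i _ "\<lambda>i. norm (x i)"]) auto
qed (auto simp: affine_space_def)

lemma continuous_on_coordinate: "continuous_on S (\<lambda>x. x i)"
  by (rule continuous_on_subset[OF continuous_on_product_coordinates]) simp

lemma continuous_on_vnorm_eval_forms: "continuous_on S (\<lambda>x. vnorm n (eval_forms n d a x))"
  unfolding vnorm_def eval_forms_def monom_eval_def
  by (intro continuous_on_sum continuous_on_norm)
    (auto intro!: continuous_on_sum continuous_on_mult continuous_on_prod continuous_on_power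
      continuous_on_const continuous_on_coordinate)

text \<open>By Tychonoff's theorem: the sphere is closed in a product of discs, with factor {0} at
  every index beyond \<open>n\<close>.\<close>

lemma compact_vnorm_sphere: "compact {x \<in> affine_space {..n}. vnorm n x = 1}"
proof -
  let ?K = "PiE UNIV (\<lambda>i. if i \<le> n then cball (0 :: complex) 1 else {0})"
  have "compactin (product_topology (\<lambda>i. euclidean) UNIV) ?K"
    by (subst compactin_PiE) auto
  then have "compact ?K"
    by (simp add: euclidean_product_topology)
  moreover have "closed {x :: nat \<Rightarrow> complex. vnorm n x = 1}"
    unfolding vnorm_def
    by (intro closed_Collect_eq continuous_on_sum continuous_on_norm continuous_on_coordinate
        continuous_on_const)
  moreover have "{x \<in> affine_space {..n}. vnorm n x = 1} = ?K \<inter> {x. vnorm n x = 1}"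
  proof (intro set_eqI iffI)
    fix x assume x: "x \<in> {x \<in> affine_space {..n}. vnorm n x = 1}"
    then have "norm (x i) \<le> 1" for i
      using norm_le_vnorm[of x n i] by simp
    then show "x \<in> ?K \<inter> {x. vnorm n x = 1}"
      using x by (auto simp: affine_space_def)
  next
    fix x assume x: "x \<in> ?K \<inter> {x. vnorm n x = 1}"
    then have "x i \<in> (if i \<le> n then cball 0 1 else {0})" for i
      by (auto simp: PiE_def Pi_def)
    then have "x i = 0" if "\<not> i \<le> n" for i
      using that by (metis singletonD)
    then show "x \<in> {x \<in> affine_space {..n}. vnorm n x = 1}"
      using x by (auto simp: affine_space_def)
  qed
  ultimately show ?thesis
    by (simp add: compact_Int_closed)
qed

lemma vnorm_sphere_nonempty: "{x \<in> affine_space {..n}. vnorm n x = 1} \<noteq> {}"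
proof -
  have "(\<lambda>i. if i = 0 then 1 else 0) \<in> {x \<in> affine_space {..n}. vnorm n x = 1}"
    by (auto simp: affine_space_def vnorm_def if_distrib[where f = norm] sum.delta cong: if_cong)
  then show ?thesis by blast
qed

lemma vnorm_normalize:
  assumes "x \<in> affine_space {..n}" "x \<noteq> (\<lambda>_. 0)"
  obtains u where "u \<in> affine_space {..n}" "vnorm n u = 1" "x = (\<lambda>i. of_real (vnorm n x) * u i)"
proof
  let ?u = "\<lambda>i. of_real (inverse (vnorm n x)) * x i"
  have "vnorm n x \<noteq> 0" using assms vnorm_eq_0_iff by blast
  then show "vnorm n ?u = 1" "x = (\<lambda>i. of_real (vnorm n x) * ?u i)"
    by (auto simp only: vnorm_scale norm_of_real) (auto simp: field_simps)
  show "?u \<in> affine_space {..n}"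
    by (rule affine_space_scale[OF assms(1)])
qed

text \<open>The maximum on the unit sphere gives the bound everywhere by homogeneity.\<close>

lemma vnorm_eval_forms_upper:
  assumes "d > 0"
  shows "\<exists>C>0. \<forall>x\<in>affine_space {..n}. vnorm n (eval_forms n d a x) \<le> C * vnorm n x ^ d"
proof -
  obtain u where "\<And>x. x \<in> affine_space {..n} \<Longrightarrow> vnorm n x = 1 \<Longrightarrow>
      vnorm n (eval_forms n d a x) \<le> vnorm n (eval_forms n d a u)"
    using continuous_attains_sup[OF compact_vnorm_sphere vnorm_sphere_nonempty
        continuous_on_vnorm_eval_forms[of _ n d a]] by force
  note u = this
  \<comment> \<open>The summand 1 makes \<open>C\<close> positive even if all forms vanish.\<close>
  define C where "C = vnorm n (eval_forms n d a u) + 1"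
  have "C > 0" by (simp add: C_def add_nonneg_pos)
  moreover have "vnorm n (eval_forms n d a x) \<le> C * vnorm n x ^ d" if x: "x \<in> affine_space {..n}" for x
  proof (cases "x = (\<lambda>_. 0)")
    case True
    have "eval_forms n d a (\<lambda>i. 0 * x i) = (\<lambda>_. 0)"
      unfolding eval_forms_scale using assms by (simp add: power_0_left)
    then show ?thesis
      using True assms by (simp add: vnorm_def power_0_left)
  next
    case False
    obtain v where v: "v \<in> affine_space {..n}" "vnorm n v = 1" "x = (\<lambda>i. of_real (vnorm n x) * v i)"
      by (rule vnorm_normalize[OF x False])
    have "vnorm n (eval_forms n d a x) = vnorm n x ^ d * vnorm n (eval_forms n d a v)"
      by (subst v(3)) (simp add: eval_forms_scale vnorm_scale norm_power)
    also have "\<dots> \<le> vnorm n x ^ d * C"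
      using u[OF v(1,2)] by (intro mult_left_mono) (auto simp: C_def)
    finally show ?thesis by (simp add: mult.commute)
  qed
  ultimately show ?thesis by blast
qed

text \<open>Nondegeneracy makes the minimum on the unit sphere positive, and homogeneity spreads the
  bound.\<close>

lemma vnorm_eval_forms_lower:
  assumes "\<And>x. x \<in> affine_space {..n} \<Longrightarrow> eval_forms n d a x = (\<lambda>_. 0) \<Longrightarrow> x = (\<lambda>_. 0)" "d > 0"
  shows "\<exists>c>0. \<forall>x\<in>affine_space {..n}. c * vnorm n x ^ d \<le> vnorm n (eval_forms n d a x)"
proof -
  obtain u where u: "u \<in> affine_space {..n}" "vnorm n u = 1"
      "\<And>x. x \<in> affine_space {..n} \<Longrightarrow> vnorm n x = 1 \<Longrightarrow>
      vnorm n (eval_forms n d a x) \<ge> vnorm n (eval_forms n d a u)"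
    using continuous_attains_inf[OF compact_vnorm_sphere vnorm_sphere_nonempty
        continuous_on_vnorm_eval_forms[of _ n d a]] by force
  define c where "c = vnorm n (eval_forms n d a u)"
  have "u \<noteq> (\<lambda>_. 0)" using u(2) by (auto simp: vnorm_def)
  then have "vnorm n (eval_forms n d a u) \<noteq> 0"
    using assms(1)[OF u(1)] vnorm_eq_0_iff[OF eval_forms_in_affine_space] by blast
  then have "c > 0" unfolding c_def using vnorm_nonneg by (metis less_eq_real_def)
  moreover have "c * vnorm n x ^ d \<le> vnorm n (eval_forms n d a x)" if x: "x \<in> affine_space {..n}" for x
  proof (cases "x = (\<lambda>_. 0)")
    case True
    then show ?thesis using assms(2) by (simp add: vnorm_def power_0_left sum_nonneg)
  next
    case False
    obtain v where v: "v \<in> affine_space {..n}" "vnorm n v = 1" "x = (\<lambda>i. of_real (vnorm n x) * v i)"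
      by (rule vnorm_normalize[OF x False])
    have "vnorm n x ^ d * c \<le> vnorm n x ^ d * vnorm n (eval_forms n d a v)"
      using u(3)[OF v(1,2)] by (intro mult_left_mono) (auto simp: c_def)
    also have "\<dots> = vnorm n (eval_forms n d a (\<lambda>i. of_real (vnorm n x) * v i))"
      by (simp add: eval_forms_scale vnorm_scale norm_power)
    also have "\<dots> = vnorm n (eval_forms n d a x)"
      by (simp only: v(3)[symmetric])
    finally show ?thesis by (simp add: mult.commute)
  qed
  ultimately show ?thesis by blast
qed

text \<open>Let F and G be the maps with coefficients \<open>a\<close> and \<open>b\<close>. The
  ball of radius \<open>\<epsilon>\<close> is forward invariant under F, while outside radius
  \<open>R\<close> every application of F at least doubles the norm. As F^m(G x) = G(F^m x) stays
  bounded in m, G x lies within radius \<open>R\<close>. Both radii are chosen before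
  \<open>b\<close>.\<close>

lemma commuting_forms_bounded:
  assumes nondeg: "\<And>x. x \<in> affine_space {..n} \<Longrightarrow> eval_forms n d a x = (\<lambda>_. 0) \<Longrightarrow> x = (\<lambda>_. 0)"
    and "d > 1"
  obtains \<epsilon> R :: real where "\<epsilon> > 0" "R > 0"
    "\<And>b x. (\<And>y. y \<in> affine_space {..n} \<Longrightarrow>
        eval_forms n d a (eval_forms n d b y) = eval_forms n d b (eval_forms n d a y)) \<Longrightarrow>
      x \<in> affine_space {..n} \<Longrightarrow> vnorm n x \<le> \<epsilon> \<Longrightarrow> vnorm n (eval_forms n d b x) \<le> R"
proof -
  have "d > 0" using assms(2) by simp
  let ?F = "eval_forms n d a"
  obtain C where C: "C > 0" "\<And>x. x \<in> affine_space {..n} \<Longrightarrow> vnorm n (?F x) \<le> C * vnorm n x ^ d"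
    using vnorm_eval_forms_upper[OF \<open>d > 0\<close>, of n a] by blast
  obtain c where c: "c > 0" "\<And>x. x \<in> affine_space {..n} \<Longrightarrow> c * vnorm n x ^ d \<le> vnorm n (?F x)"
    using vnorm_eval_forms_lower[OF nondeg \<open>d > 0\<close>] by blast
  obtain k where k: "d = Suc (Suc k)"
    using assms(2) by (auto dest!: less_imp_Suc_add)
  \<comment> \<open>The bound \<open>1 / C\<close> keeps the small ball invariant and
    \<open>2 / c\<close> yields the doubling; the comparisons with 1 control the remaining powers of
    the norm.\<close>
  define \<epsilon> where "\<epsilon> = min 1 (1 / C)"
  define R where "R = max 1 (2 / c)"
  have eps: "\<epsilon> > 0" "\<epsilon> \<le> 1" "C * \<epsilon> \<le> 1"
    using C(1) by (auto simp: \<epsilon>_def min_def field_simps)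
  have R: "R \<ge> 1" "c * R \<ge> 2"
    using c(1) by (auto simp: R_def max_def field_simps)
  have step: "vnorm n (?F x) \<le> \<epsilon>" if x: "x \<in> affine_space {..n}" "vnorm n x \<le> \<epsilon>" for x
  proof -
    have "vnorm n (?F x) \<le> C * \<epsilon> ^ d"
      using C(1) x by (intro order_trans[OF C(2)] mult_left_mono power_mono) auto
    also have "\<dots> = (C * \<epsilon>) * (\<epsilon> ^ k * \<epsilon>)" by (simp add: k)
    also have "\<dots> \<le> 1 * (1 * \<epsilon>)"
      using eps C(1) by (intro mult_mono power_le_one) auto
    finally show ?thesis by simp
  qed
  have aff: "(?F ^^ m) x \<in> affine_space {..n}" if "x \<in> affine_space {..n}" for x m
    using that by (cases m) auto
  have orbit: "vnorm n ((?F ^^ m) x) \<le> \<epsilon>" if x: "x \<in> affine_space {..n}" "vnorm n x \<le> \<epsilon>" for x m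
    by (induction m) (use x aff step in auto)
  have escape: "vnorm n ((?F ^^ m) y) \<ge> R * 2 ^ m" if y: "y \<in> affine_space {..n}" "vnorm n y > R" for y m
  proof (induction m)
    case 0
    then show ?case using y by simp
  next
    case (Suc m)
    let ?r = "vnorm n ((?F ^^ m) y)"
    have "R * 1 \<le> R * 2 ^ m"
      using R by (intro mult_left_mono) auto
    then have r: "?r \<ge> R" using Suc by simp
    have "2 * ?r \<le> (c * R) * ?r"
      using R by (intro mult_right_mono) auto
    also have "\<dots> \<le> (c * (?r * ?r ^ k)) * ?r"
    proof (intro mult_right_mono mult_left_mono)
      have "R * 1 \<le> ?r * ?r ^ k"
        using r R by (intro mult_mono one_le_power) auto
      then show "R \<le> ?r * ?r ^ k" by simp
    qed (use c(1) in auto)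
    also have "\<dots> = c * ?r ^ d" by (simp add: k)
    also have "\<dots> \<le> vnorm n (?F ((?F ^^ m) y))"
      by (rule c(2)[OF aff[OF y(1)]])
    finally show ?case using Suc by simp
  qed
  have "vnorm n (eval_forms n d b x) \<le> R"
    if comm: "\<And>y. y \<in> affine_space {..n} \<Longrightarrow> ?F (eval_forms n d b y) = eval_forms n d b (?F y)"
      and x: "x \<in> affine_space {..n}" "vnorm n x \<le> \<epsilon>" for b x
  proof (rule ccontr)
    assume "\<not> ?thesis"
    then have big: "vnorm n ((?F ^^ m) (eval_forms n d b x)) \<ge> R * 2 ^ m" for m
      using escape by simp
    \<comment> \<open>\<open>D\<close> may depend on \<open>b\<close>; it only has to be the same
      for all \<open>m\<close>.\<close>
    obtain D where D: "D > 0" "\<And>x. x \<in> affine_space {..n} \<Longrightarrow> vnorm n (eval_forms n d b x) \<le> D * vnorm n x ^ d"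
      using vnorm_eval_forms_upper[OF \<open>d > 0\<close>, of n b] by blast
    have "(?F ^^ m) (eval_forms n d b x) = eval_forms n d b ((?F ^^ m) x)" for m
      by (induction m) (use comm aff x in auto)
    then have "R * 2 ^ m \<le> D" for m
    proof -
      have "R * 2 ^ m \<le> vnorm n (eval_forms n d b ((?F ^^ m) x))"
        using big[of m] \<open>(?F ^^ m) (eval_forms n d b x) = _\<close> by simp
      also have "\<dots> \<le> D * vnorm n ((?F ^^ m) x) ^ d"
        by (rule D(2)[OF aff[OF x(1)]])
      also have "\<dots> \<le> D * 1"
        using D(1) orbit[OF x, of m] eps by (intro mult_left_mono power_le_one) auto
      finally show ?thesis by simp
    qed
    moreover obtain m where "2 ^ m > D"
      using real_arch_pow[of 2 D] by auto
    moreover have "1 * 2 ^ m \<le> R * 2 ^ m"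
      using R by (intro mult_right_mono) auto
    ultimately show False by (metis mult_1 not_le order_trans)
  qed
  then show ?thesis
    using that[of \<epsilon> R] eps R by force
qed

section \<open>The proportionality factor of commuting lifts\<close>

lemma holomorphic_eval_forms:
  assumes "\<And>i. (\<lambda>s. f s i) holomorphic_on S"
  shows "(\<lambda>s. eval_forms n d a (f s) i) holomorphic_on S"
  unfolding eval_forms_def monom_eval_def
  using assms by (cases "i \<le> n") (auto intro!: holomorphic_intros)

text \<open>Near each \<open>s\<close> the factor is a quotient \<open>P t i / Q t i\<close> with
  nonvanishing denominator, so it is entire; being bounded, it is constant by Liouville's
  theorem.\<close>

lemma proportional_along_line:
  fixes P Q :: "complex \<Rightarrow> nat \<Rightarrow> complex" and \<kappa> :: "complex \<Rightarrow> complex"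
  assumes "\<And>i. (\<lambda>s. P s i) holomorphic_on UNIV" "\<And>i. (\<lambda>s. Q s i) holomorphic_on UNIV"
    and "\<And>s. \<exists>i. Q s i \<noteq> 0" "\<And>s i. P s i = \<kappa> s * Q s i" "\<And>s. norm (\<kappa> s) \<le> B"
  shows "\<kappa> s = \<kappa> t"
proof -
  have "\<kappa> field_differentiable at s" for s
  proof -
    obtain i where i: "Q s i \<noteq> 0" using assms(3) by blast
    let ?U = "{t. Q t i \<noteq> 0}"
    have "open ?U"
      using holomorphic_on_imp_continuous_on[OF assms(2)]
      by (intro open_Collect_neq continuous_on_const)
    moreover have "\<kappa> holomorphic_on ?U"
    proof (rule holomorphic_transform)
      show "(\<lambda>t. P t i / Q t i) holomorphic_on ?U"
        by (intro holomorphic_on_divide holomorphic_on_subset[OF assms(1)]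
            holomorphic_on_subset[OF assms(2)]) auto
    qed (simp add: assms(4))
    ultimately show ?thesis
      using i holomorphic_on_imp_differentiable_at by blast
  qed
  then have "\<kappa> holomorphic_on UNIV"
    by (simp add: holomorphic_on_def field_differentiable_at_within)
  moreover have "bounded (range \<kappa>)"
    using assms(5) by (auto simp: bounded_iff)
  ultimately have "\<kappa> constant_on UNIV"
    by (rule Liouville_theorem)
  then show ?thesis
    by (auto simp: constant_on_def)
qed

text \<open>Meant for the two composites of a pair of lifts. The growth bounds make the factor
  bounded, hence constant on affine lines missing the origin; equal degrees make it constant on
  lines through the origin.\<close>

lemma proportionality_factor_constant:
  fixes P Q :: "(nat \<Rightarrow> complex) \<Rightarrow> nat \<Rightarrow> complex"
  assumes hol: "\<And>x y i. (\<lambda>s. P (\<lambda>j. x j + s * y j) i) holomorphic_on UNIV"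
      "\<And>x y i. (\<lambda>s. Q (\<lambda>j. x j + s * y j) i) holomorphic_on UNIV"
    and hom: "\<And>r x. P (\<lambda>j. r * x j) = (\<lambda>j. r ^ e * P x j)" "\<And>r x. Q (\<lambda>j. r * x j) = (\<lambda>j. r ^ e * Q x j)"
    and upper: "\<And>x. x \<in> affine_space {..n} \<Longrightarrow> vnorm n (P x) \<le> C * vnorm n x ^ e"
    and lower: "c > 0" "\<And>x. x \<in> affine_space {..n} \<Longrightarrow> c * vnorm n x ^ e \<le> vnorm n (Q x)"
    and proportional: "\<And>x. x \<in> affine_space {..n} \<Longrightarrow> x \<noteq> (\<lambda>_. 0) \<Longrightarrow> \<exists>k. P x = (\<lambda>i. k * Q x i)"
  obtains k where "\<And>x. x \<in> affine_space {..n} \<Longrightarrow> x \<noteq> (\<lambda>_. 0) \<Longrightarrow> P x = (\<lambda>i. k * Q x i)"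
proof -
  let ?V = "{x \<in> affine_space {..n}. x \<noteq> (\<lambda>_. 0)}"
  have "\<forall>x\<in>?V. \<exists>k. P x = (\<lambda>i. k * Q x i)"
    using proportional by simp
  from bchoice[OF this] obtain \<kappa> where \<kappa>: "\<And>x. x \<in> ?V \<Longrightarrow> P x = (\<lambda>i. \<kappa> x * Q x i)"
    by blast
  have pos: "vnorm n x > 0" if "x \<in> ?V" for x
    using that vnorm_eq_0_iff[of x n] vnorm_nonneg[of n x] by (auto simp: less_eq_real_def)
  have Qpos: "vnorm n (Q x) > 0" if "x \<in> ?V" for x
  proof -
    have "0 < c * vnorm n x ^ e" using lower(1) pos[OF that] by simp
    also have "\<dots> \<le> vnorm n (Q x)" using lower(2) that by simp
    finally show ?thesis .
  qed
  have Q0: "\<exists>i. Q x i \<noteq> 0" if "x \<in> ?V" for x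
  proof (rule ccontr)
    assume "\<nexists>i. Q x i \<noteq> 0"
    then show False using Qpos[OF that] by (simp add: vnorm_def)
  qed
  have bound: "norm (\<kappa> x) \<le> C / c" if x: "x \<in> ?V" for x
  proof -
    have "norm (\<kappa> x) * (c * vnorm n x ^ e) \<le> norm (\<kappa> x) * vnorm n (Q x)"
      using lower(2) x by (intro mult_left_mono) auto
    also have "\<dots> = vnorm n (P x)"
      using \<kappa>[OF x] by (simp add: vnorm_scale)
    also have "\<dots> \<le> C * vnorm n x ^ e"
      using upper x by auto
    finally have "norm (\<kappa> x) * c \<le> C"
      using pos[OF x] by (simp add: mult.assoc[symmetric])
    then show ?thesis
      using lower(1) by (simp add: field_simps)
  qed
  have line: "\<kappa> x = \<kappa> (\<lambda>j. x j + y j)"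
    if y: "y \<in> affine_space {..n}" "\<And>s. (\<lambda>j. x j + s * y j) \<noteq> (\<lambda>_. 0)" and x: "x \<in> affine_space {..n}" for x y
  proof -
    have V: "(\<lambda>j. x j + s * y j) \<in> ?V" for s
      using x y by (auto simp: affine_space_def)
    have P: "P (\<lambda>j. x j + s * y j) i = \<kappa> (\<lambda>j. x j + s * y j) * Q (\<lambda>j. x j + s * y j) i" for s i
      using fun_cong[OF \<kappa>[OF V[of s]], of i] .
    have "\<kappa> (\<lambda>j. x j + 0 * y j) = \<kappa> (\<lambda>j. x j + 1 * y j)"
      by (rule proportional_along_line[where \<kappa> = "\<lambda>s. \<kappa> (\<lambda>j. x j + s * y j)",
          OF hol(1)[of x y] hol(2)[of x y] Q0[OF V] P bound[OF V]])
    then show ?thesis by simp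
  qed
  have scale: "\<kappa> (\<lambda>j. r * x j) = \<kappa> x" if x: "x \<in> ?V" "r \<noteq> 0" for r x
  proof -
    have rx: "(\<lambda>j. r * x j) \<in> ?V"
      using x by (auto simp: affine_space_def fun_eq_iff)
    obtain i where "Q x i \<noteq> 0" using Q0[OF x(1)] by blast
    moreover have "r ^ e * P x i = \<kappa> (\<lambda>j. r * x j) * (r ^ e * Q x i)"
      using fun_cong[OF \<kappa>[OF rx], of i] by (simp only: hom)
    ultimately show ?thesis
      using x(2) \<kappa>[OF x(1)] by simp
  qed
  have const: "\<kappa> x = \<kappa> y" if x: "x \<in> ?V" and y: "y \<in> ?V" for x y
  proof (cases "\<exists>r. x = (\<lambda>j. r * y j)")
    case True
    then obtain r where r: "x = (\<lambda>j. r * y j)" by blast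
    then have "r \<noteq> 0" using x by auto
    then show ?thesis using scale[OF y] r by simp
  next
    case False
    \<comment> \<open>For nonproportional \<open>x\<close> and \<open>y\<close>, the line through
      \<open>x\<close> in direction \<open>y\<close> and the line through \<open>y\<close> in
      direction \<open>x\<close> miss the origin and meet at their sum.\<close>
    have "(\<lambda>j. x j + s * y j) \<noteq> (\<lambda>_. 0)" for s
      using False by (metis add.right_inverse add_right_imp_eq add.commute mult_minus_left)
    moreover have "(\<lambda>j. y j + s * x j) \<noteq> (\<lambda>_. 0)" for s
    proof
      assume eq: "(\<lambda>j. y j + s * x j) = (\<lambda>_. 0)"
      then have "s \<noteq> 0" using y by auto
      have "x j = (- 1 / s) * y j" for j
        using fun_cong[OF eq, of j] \<open>s \<noteq> 0\<close> by (simp add: field_simps add_eq_0_iff)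
      then show False using False by blast
    qed
    ultimately show ?thesis
      using line[of y x] line[of x y] x y by (simp add: add.commute)
  qed
  have "\<exists>k. \<forall>x\<in>?V. \<kappa> x = k"
    using const by (cases "?V = {}") blast+
  then show ?thesis
    using that \<kappa> by auto
qed

text \<open>Since the endomorphisms commute, the two composites of lifts are proportional at each
  nonzero point. Both have degree \<open>d * d\<close> and growth of that order from above and
  below, so the factor is one constant.\<close>

lemma commuting_lifts:
  assumes "\<phi> \<in> Mor n d" "\<psi> \<in> Mor n d" "a \<in> \<phi>" "b \<in> \<psi>" "d > 0"
    and comm: "\<forall>P\<in>proj_space {..n}. endo n d \<phi> (endo n d \<psi> P) = endo n d \<psi> (endo n d \<phi> P)"
  shows "\<exists>c. c \<noteq> 0 \<and> (\<forall>x\<in>affine_space {..n}.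
    eval_forms n d a (eval_forms n d b x) = (\<lambda>i. c * eval_forms n d b (eval_forms n d a x) i))"
proof -
  let ?F = "eval_forms n d a" and ?G = "eval_forms n d b"
  have nonF: "x = (\<lambda>_. 0)" if "x \<in> affine_space {..n}" "?F x = (\<lambda>_. 0)" for x
    using assms(1,3) that by (auto simp: Mor_def)
  have nonG: "x = (\<lambda>_. 0)" if "x \<in> affine_space {..n}" "?G x = (\<lambda>_. 0)" for x
    using assms(2,4) that by (auto simp: Mor_def)
  obtain C where C: "C > 0" "\<And>x. x \<in> affine_space {..n} \<Longrightarrow> vnorm n (?F x) \<le> C * vnorm n x ^ d"
    using vnorm_eval_forms_upper[OF \<open>d > 0\<close>, of n a] by blast
  obtain C' where C': "C' > 0" "\<And>x. x \<in> affine_space {..n} \<Longrightarrow> vnorm n (?G x) \<le> C' * vnorm n x ^ d"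
    using vnorm_eval_forms_upper[OF \<open>d > 0\<close>, of n b] by blast
  obtain c where c: "c > 0" "\<And>x. x \<in> affine_space {..n} \<Longrightarrow> c * vnorm n x ^ d \<le> vnorm n (?F x)"
    using vnorm_eval_forms_lower[OF nonF \<open>d > 0\<close>] by blast
  obtain c' where c': "c' > 0" "\<And>x. x \<in> affine_space {..n} \<Longrightarrow> c' * vnorm n x ^ d \<le> vnorm n (?G x)"
    using vnorm_eval_forms_lower[OF nonG \<open>d > 0\<close>] by blast
  have proportional: "\<exists>k. ?F (?G x) = (\<lambda>i. k * ?G (?F x) i) \<and> k \<noteq> 0"
    if x: "x \<in> affine_space {..n}" "x \<noteq> (\<lambda>_. 0)" for x
  proof -
    have mem: "y \<in> proj_point y" for y :: "nat \<Rightarrow> complex"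
      by (auto simp: proj_point_def intro!: exI[of _ 1])
    have P: "proj_point x \<in> proj_space {..n}"
      using x by (auto simp: proj_space_def)
    note F = endo_proj_point[OF assms(1,3) P mem]
    note G = endo_proj_point[OF assms(2,4) P mem]
    have "endo n d \<phi> (endo n d \<psi> (proj_point x)) = proj_point (?F (?G x))"
      by (rule endo_proj_point(1)[OF assms(1,3) G(2)]) (simp add: G(1) mem)
    moreover have "endo n d \<psi> (endo n d \<phi> (proj_point x)) = proj_point (?G (?F x))"
      by (rule endo_proj_point(1)[OF assms(2,4) F(2)]) (simp add: F(1) mem)
    ultimately have "?F (?G x) \<in> proj_point (?G (?F x))"
      using comm P mem by metis
    then show ?thesis by (auto simp: proj_point_def)
  qed
  have hol: "(\<lambda>s. x j + s * y j) holomorphic_on UNIV" for x y :: "nat \<Rightarrow> complex" and j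
    by (intro holomorphic_intros)
  obtain k where k: "\<And>x. x \<in> affine_space {..n} \<Longrightarrow> x \<noteq> (\<lambda>_. 0) \<Longrightarrow> ?F (?G x) = (\<lambda>i. k * ?G (?F x) i)"
  proof (rule proportionality_factor_constant[of "\<lambda>x. ?F (?G x)" "\<lambda>x. ?G (?F x)" "d * d" n
        "C * C' ^ d" "c' * c ^ d"])
    show "vnorm n (?F (?G x)) \<le> C * C' ^ d * vnorm n x ^ (d * d)" if "x \<in> affine_space {..n}" for x
    proof -
      have "vnorm n (?F (?G x)) \<le> C * (C' * vnorm n x ^ d) ^ d"
        using C(1) C'(2)[OF that] by (intro order_trans[OF C(2)] mult_left_mono power_mono) auto
      then show ?thesis by (simp add: power_mult_distrib power_mult)
    qed
    show "c' * c ^ d * vnorm n x ^ (d * d) \<le> vnorm n (?G (?F x))" if "x \<in> affine_space {..n}" for x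
    proof -
      have "c' * (c * vnorm n x ^ d) ^ d \<le> vnorm n (?G (?F x))"
        using c c'(1) that by (intro order_trans[OF _ c'(2)] mult_left_mono power_mono) auto
      then show ?thesis by (simp add: power_mult_distrib power_mult)
    qed
    show "0 < c' * c ^ d" using c c' by simp
  qed (use proportional in \<open>auto simp: eval_forms_scale power_mult[symmetric] intro!: holomorphic_eval_forms hol\<close>)
  \<comment> \<open>As \<open>d > 0\<close>, both composites vanish at the origin, so the equation
    extends to it.\<close>
  have F0: "?F (\<lambda>_. 0) = (\<lambda>_. 0)" and G0: "?G (\<lambda>_. 0) = (\<lambda>_. 0)"
    using eval_forms_scale[of n d a 0 "\<lambda>_. 0"] eval_forms_scale[of n d b 0 "\<lambda>_. 0"] assms(5)
    by (simp_all add: power_0_left)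
  have k': "?F (?G x) = (\<lambda>i. k * ?G (?F x) i)" if "x \<in> affine_space {..n}" for x
    using k[OF that] by (cases "x = (\<lambda>_. 0)") (simp_all add: F0 G0)
  have "k \<noteq> 0"
  proof
    assume "k = 0"
    define x :: "nat \<Rightarrow> complex" where "x = (\<lambda>i. if i = 0 then 1 else 0)"
    have x: "x \<in> affine_space {..n}" "x \<noteq> (\<lambda>_. 0)"
      by (auto simp: x_def affine_space_def fun_eq_iff)
    have "?F (?G x) = (\<lambda>_. 0)" using k'[OF x(1)] \<open>k = 0\<close> by simp
    then show False using nonF nonG x eval_forms_in_affine_space by blast
  qed
  then show ?thesis using k' by blast
qed

text \<open>Multiplying \<open>b\<close> by \<open>l\<close> multiplies one composite by
  \<open>l ^ d\<close> and the other by \<open>l\<close>, so \<open>l ^ (d - 1) * c = 1\<close>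
  makes the lifts commute exactly. As \<open>\<epsilon>\<close> and \<open>R\<close> precede
  \<open>b\<close> and \<open>c\<close>, the bound is uniform.\<close>

lemma commuting_normalized_bound:
  assumes "\<phi> \<in> Mor n d" "a \<in> \<phi>" "d > 1"
  shows "\<exists>\<epsilon>>0. \<exists>R>0. \<forall>b c. c \<noteq> 0 \<longrightarrow>
    (\<forall>y\<in>affine_space {..n}. eval_forms n d a (eval_forms n d b y) =
      (\<lambda>i. c * eval_forms n d b (eval_forms n d a y) i)) \<longrightarrow>
    (\<exists>l. l ^ (d - 1) * c = 1 \<and> (\<forall>x i. x \<in> affine_space {..n} \<longrightarrow> vnorm n x \<le> \<epsilon> \<longrightarrow>
        norm (l * eval_forms n d b x i) \<le> R))"
proof -
  have non: "x = (\<lambda>_. 0)" if "x \<in> affine_space {..n}" "eval_forms n d a x = (\<lambda>_. 0)" for x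
    using assms(1,2) that by (auto simp: Mor_def)
  obtain \<epsilon> R :: real where eR: "\<epsilon> > 0" "R > 0"
    "\<And>b x. (\<And>y. y \<in> affine_space {..n} \<Longrightarrow>
        eval_forms n d a (eval_forms n d b y) = eval_forms n d b (eval_forms n d a y)) \<Longrightarrow>
      x \<in> affine_space {..n} \<Longrightarrow> vnorm n x \<le> \<epsilon> \<Longrightarrow> vnorm n (eval_forms n d b x) \<le> R"
    using commuting_forms_bounded[OF non assms(3)] by blast
  have "\<exists>l. l ^ (d - 1) * c = 1 \<and> (\<forall>x i. x \<in> affine_space {..n} \<longrightarrow> vnorm n x \<le> \<epsilon> \<longrightarrow>
        norm (l * eval_forms n d b x i) \<le> R)"
    if comm: "\<And>y. y \<in> affine_space {..n} \<Longrightarrow>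
        eval_forms n d a (eval_forms n d b y) = (\<lambda>i. c * eval_forms n d b (eval_forms n d a y) i)"
      and "c \<noteq> 0" for b c
  proof -
    \<comment> \<open>A root of order \<open>d - 1\<close> of \<open>inverse c\<close>.\<close>
    define l where "l = exp (Ln (inverse c) / of_nat (d - 1))"
    have "l ^ (d - 1) = inverse c"
      using assms(3) \<open>c \<noteq> 0\<close> unfolding l_def exp_of_nat_mult[symmetric] by simp
    then have l: "l ^ (d - 1) * c = 1" using \<open>c \<noteq> 0\<close> by simp
    have ld: "l ^ d = l * l ^ (d - 1)"
      using assms(3) by (simp add: power_eq_if)
    let ?b = "\<lambda>j. l * b j"
    have "eval_forms n d a (eval_forms n d ?b y) = eval_forms n d ?b (eval_forms n d a y)"
      if "y \<in> affine_space {..n}" for y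
    proof -
      have "l ^ d * c = l"
        using l by (simp add: ld mult.assoc)
      then show ?thesis
        unfolding eval_forms_coeff_scale eval_forms_scale comm[OF that] by (simp add: mult.assoc[symmetric])
    qed
    then have "vnorm n (eval_forms n d ?b x) \<le> R" if "x \<in> affine_space {..n}" "vnorm n x \<le> \<epsilon>" for x
      using eR(3)[of ?b x] that by blast
    then have "norm (eval_forms n d ?b x i) \<le> R" if "x \<in> affine_space {..n}" "vnorm n x \<le> \<epsilon>" for x i
      using norm_le_vnorm[OF eval_forms_in_affine_space[of n d ?b x], of i] that by (meson order_trans)
    then show ?thesis
      unfolding eval_forms_coeff_scale using l by blast
  qed
  then show ?thesis using eR(1,2) by (intro exI[of _ \<epsilon>] exI[of _ R] conjI allI impI) auto
qed


section \<open>Forms determined by their values on a grid\<close>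

text \<open>Induction on the variables: with the others fixed, the sum is a polynomial of degree at
  most \<open>D\<close> in one variable with more than \<open>D\<close> roots, so its coefficients
  vanish. Monomials are an abstract index set \<open>M\<close> with exponents \<open>e\<close>, so
  they keep their type when a variable is removed.\<close>

lemma grid_polynomial_zero:
  fixes e :: "'m \<Rightarrow> 'v \<Rightarrow> nat" and b :: "'m \<Rightarrow> 'a::{comm_ring_1,ring_no_zero_divisors}"
  assumes "finite I" "finite M" "finite A" "card A > D"
    and "\<And>J v. J \<in> M \<Longrightarrow> v \<in> I \<Longrightarrow> e J v \<le> D"
    and "\<And>J K. J \<in> M \<Longrightarrow> K \<in> M \<Longrightarrow> \<forall>v\<in>I. e J v = e K v \<Longrightarrow> J = K"
    and "\<And>x. \<forall>v\<in>I. x v \<in> A \<Longrightarrow> (\<Sum>J\<in>M. b J * (\<Prod>v\<in>I. x v ^ e J v)) = 0"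
    and "J \<in> M"
  shows "b J = 0"
  using assms(1,2,5-8)
proof (induction I arbitrary: M rule: finite_induct)
  case empty
  \<comment> \<open>Without variables \<open>M\<close> has a single element, and the vanishing sum
    is \<open>b J\<close>.\<close>
  have "M = {J}" using empty by auto
  then show ?case using empty(4)[of undefined] by simp
next
  case (insert i I)
  let ?M = "{K \<in> M. e K i = e J i}"
  show ?case
  proof (rule insert.IH)
    show "J' = K" if "J' \<in> ?M" "K \<in> ?M" "\<forall>v\<in>I. e J' v = e K v" for J' K
      using insert.prems(3)[of J' K] that by auto
    show "(\<Sum>J\<in>?M. b J * (\<Prod>v\<in>I. x v ^ e J v)) = 0" if x: "\<forall>v\<in>I. x v \<in> A" for x
    proof -
      let ?c = "\<lambda>K. b K * (\<Prod>v\<in>I. x v ^ e K v)"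
      define p where "p = (\<Sum>K\<in>M. Polynomial.monom (?c K) (e K i))"
      have "poly p a = 0" if "a \<in> A" for a
      proof -
        have "(\<Prod>v\<in>I. (x(i := a)) v ^ e K v) = (\<Prod>v\<in>I. x v ^ e K v)" for K
          using insert.hyps(2) by (intro prod.cong) auto
        then have "(\<Prod>v\<in>insert i I. (x(i := a)) v ^ e K v) = a ^ e K i * (\<Prod>v\<in>I. x v ^ e K v)" for K
          using insert.hyps by simp
        moreover have "(\<Sum>K\<in>M. b K * (\<Prod>v\<in>insert i I. (x(i := a)) v ^ e K v)) = 0"
          by (rule insert.prems(4)) (use x \<open>a \<in> A\<close> in auto)
        ultimately show ?thesis
          by (simp add: p_def poly_sum poly_monom mult_ac)
      qed
      then have "A \<subseteq> {a. poly p a = 0}" by auto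
      moreover have "degree p \<le> D"
        unfolding p_def using insert.prems(1,2)
        by (intro degree_sum_le) (auto intro!: order_trans[OF degree_monom_le])
      ultimately have "p = 0"
        using assms(4) card_poly_roots_bound[of p] card_mono[of "{a. poly p a = 0}" A] poly_roots_finite[of p]
        by (metis le_trans not_le)
      \<comment> \<open>This coefficient collects exactly the monomials in
        \<open>?M\<close>.\<close>
      then have "coeff p (e J i) = 0" by simp
      then have "(\<Sum>K\<in>M. if e K i = e J i then ?c K else 0) = 0"
        by (simp add: p_def coeff_sum)
      then show ?thesis
        using insert.prems(1) by (simp add: sum.If_cases Int_def)
    qed
  qed (use insert.prems in auto)
qed

text \<open>For \<open>r \<noteq> 0\<close> each coordinate takes \<open>d + 1\<close> values, one
  more than the degree; a small \<open>r\<close> puts the grid into a given ball around the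
  origin.\<close>

definition grid :: "nat \<Rightarrow> nat \<Rightarrow> complex \<Rightarrow> (nat \<Rightarrow> complex) set" where
  "grid n d r = {x \<in> affine_space {..n}. \<forall>i\<le>n. x i \<in> (\<lambda>k. of_nat k * r) ` {..d}}"

lemma finite_grid: "finite (grid n d r)"
proof -
  have "grid n d r \<subseteq> {x. \<forall>i. (i \<in> {..n} \<longrightarrow> x i \<in> (\<lambda>k. of_nat k * r) ` {..d}) \<and> (i \<notin> {..n} \<longrightarrow> x i = 0)}"
    by (auto simp: grid_def affine_space_def)
  then show ?thesis
    by (rule finite_subset) (rule finite_set_of_finite_funs; simp)
qed

lemma lookup_le_monom_degree: "Poly_Mapping.lookup J i \<le> monom_degree J"
  unfolding monom_degree_def
  by (cases "i \<in> Poly_Mapping.keys J") (auto intro: member_le_sum simp: in_keys_iff)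

lemma eval_forms_grid_zero:
  assumes "r \<noteq> 0" "i \<le> n" "J \<in> monoms n d" "\<And>x. x \<in> grid n d r \<Longrightarrow> eval_forms n d b x i = 0"
  shows "b (i, J) = 0"
proof (rule grid_polynomial_zero[where I = "{..n}" and M = "monoms n d" and D = d
      and A = "(\<lambda>k. of_nat k * r) ` {..d}" and e = Poly_Mapping.lookup and b = "\<lambda>J. b (i, J)"])
  have "inj (\<lambda>k. of_nat k * r)" using assms(1) by (auto intro!: injI)
  then show "d < card ((\<lambda>k. of_nat k * r) ` {..d})"
    by (subst card_image) (auto intro: inj_on_subset)
  show "Poly_Mapping.lookup J v \<le> d" if "J \<in> monoms n d" for J v
    using that lookup_le_monom_degree[of J v] by (simp add: monoms_def)
  show "J = K" if "J \<in> monoms n d" "K \<in> monoms n d" "\<forall>v\<in>{..n}. Poly_Mapping.lookup J v = Poly_Mapping.lookup K v" for J K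
  proof (rule poly_mapping_eqI)
    fix v
    show "Poly_Mapping.lookup J v = Poly_Mapping.lookup K v"
    proof (cases "v \<le> n")
      case False
      then have "v \<notin> Poly_Mapping.keys J" "v \<notin> Poly_Mapping.keys K"
        using that by (auto simp: monoms_def)
      then show ?thesis by (simp add: in_keys_iff)
    qed (use that in auto)
  qed
  show "(\<Sum>J\<in>monoms n d. b (i, J) * (\<Prod>v\<in>{..n}. x v ^ Poly_Mapping.lookup J v)) = 0"
    if x: "\<forall>v\<in>{..n}. x v \<in> (\<lambda>k. of_nat k * r) ` {..d}" for x
  proof -
    let ?x = "\<lambda>v. if v \<le> n then x v else 0"
    have "?x \<in> grid n d r" using x by (auto simp: grid_def affine_space_def)
    then have "eval_forms n d b ?x i = 0" by (rule assms(4))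
    moreover have "monom_eval J ?x = (\<Prod>v\<in>{..n}. x v ^ Poly_Mapping.lookup J v)" if "J \<in> monoms n d" for J
      using that by (subst monom_eval_superset[of "{..n}"]) (auto simp: monoms_def)
    ultimately show ?thesis
      using assms(2) by (simp add: eval_forms_def)
  qed
qed (use assms finite_monoms in auto)


section \<open>Forms in the coefficients\<close>

lemma forms_in_add: "p \<in> forms_in I e \<Longrightarrow> q \<in> forms_in I e \<Longrightarrow> p + q \<in> forms_in I e"
  using keys_add[of p q] by (auto simp: forms_in_def polys_in_def) blast+

lemma forms_in_0 [simp]: "0 \<in> forms_in I e"
  by (simp add: forms_in_def polys_in_def)

lemma forms_in_sum: "(\<And>k. k \<in> A \<Longrightarrow> p k \<in> forms_in I e) \<Longrightarrow> sum p A \<in> forms_in I e"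
  by (induction A rule: infinite_finite_induct) (auto intro: forms_in_add)

lemma cst_in_forms: "cst c \<in> forms_in I 0"
  by (simp add: forms_in_def polys_in_def monom_degree_def)

lemma indet_in_forms: "v \<in> I \<Longrightarrow> indet v \<in> forms_in I 1"
  by (simp add: indet_def forms_in_def polys_in_def monom_degree_def)

lemma cst_indet_in_forms: "v \<in> I \<Longrightarrow> cst c * indet v \<in> forms_in I 1"
  using forms_in_mult[OF cst_in_forms indet_in_forms] by (simp only: add_0)

lemma forms_in_power: "p \<in> forms_in I e \<Longrightarrow> p ^ k \<in> forms_in I (k * e)"
proof (induction k)
  case 0
  then show ?case using cst_in_forms[of 1 I] by simp
next
  case (Suc k)
  then show ?case using forms_in_mult[of p I e "p ^ k" "k * e"] by simp
qed

lemma forms_in_prod: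
  "(\<And>k. k \<in> A \<Longrightarrow> p k \<in> forms_in I (e k)) \<Longrightarrow> finite A \<Longrightarrow> prod p A \<in> forms_in I (sum e A)"
proof (induction A rule: infinite_finite_induct)
  case empty
  then show ?case using cst_in_forms[of 1 I] by simp
qed (simp_all add: forms_in_mult)

lemma poly_eval_power: "poly_eval (p ^ k) x = poly_eval p x ^ k"
  by (induction k) (simp_all add: poly_eval_mult)

lemma poly_eval_prod: "poly_eval (prod p A) x = (\<Prod>k\<in>A. poly_eval (p k) x)"
  by (induction A rule: infinite_finite_induct) (simp_all add: poly_eval_mult)

text \<open>Coefficients and variables exchange roles: at a fixed point \<open>w\<close> the value
  is a linear form whose indeterminates are the coefficients.\<close>

definition value_form :: "nat \<Rightarrow> nat \<Rightarrow> (nat \<Rightarrow> complex) \<Rightarrow> nat \<Rightarrow> (nat \<times> nat monom) cpoly" where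
  "value_form n d w i = (\<Sum>J\<in>monoms n d. cst (monom_eval J w) * indet (i, J))"

lemma poly_eval_value_form: "i \<le> n \<Longrightarrow> poly_eval (value_form n d w i) b = eval_forms n d b w i"
  by (simp add: value_form_def poly_eval_sum poly_eval_mult eval_forms_def mult.commute)

lemma value_form_in_forms: "i \<le> n \<Longrightarrow> value_form n d w i \<in> forms_in (coeff_index n d) 1"
  unfolding value_form_def
proof (rule forms_in_sum)
  fix J assume "i \<le> n" "J \<in> monoms n d"
  then have "(i, J) \<in> coeff_index n d" by (simp add: coeff_index_def)
  then show "cst (monom_eval J w) * indet (i, J) \<in> forms_in (coeff_index n d) 1"
    by (rule cst_indet_in_forms)
qed

text \<open>The value at \<open>w\<close> of the fixed map \<open>a\<close> after a variable map, as
  a form of degree \<open>d\<close> in the coefficients of the latter.\<close>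

definition composite_form ::
  "nat \<Rightarrow> nat \<Rightarrow> (nat \<times> nat monom \<Rightarrow> complex) \<Rightarrow> (nat \<Rightarrow> complex) \<Rightarrow> nat \<Rightarrow> (nat \<times> nat monom) cpoly" where
  "composite_form n d a w k =
    (\<Sum>J\<in>monoms n d. cst (a (k, J)) * (\<Prod>v\<le>n. value_form n d w v ^ Poly_Mapping.lookup J v))"

lemma poly_eval_composite_form:
  assumes "k \<le> n"
  shows "poly_eval (composite_form n d a w k) b = eval_forms n d a (eval_forms n d b w) k"
proof -
  have "monom_eval J (eval_forms n d b w) =
      (\<Prod>v\<le>n. poly_eval (value_form n d w v) b ^ Poly_Mapping.lookup J v)" if "J \<in> monoms n d" for J
    using that by (subst monom_eval_superset[of "{..n}"]) (auto simp: monoms_def poly_eval_value_form)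
  then show ?thesis
    using assms by (simp add: composite_form_def poly_eval_sum poly_eval_mult poly_eval_prod
        poly_eval_power eval_forms_def[of n d a])
qed

lemma composite_form_in_forms: "composite_form n d a w k \<in> forms_in (coeff_index n d) d"
  unfolding composite_form_def
proof (rule forms_in_sum)
  fix J assume J: "J \<in> monoms n d"
  have "(\<Prod>v\<le>n. value_form n d w v ^ Poly_Mapping.lookup J v) \<in>
      forms_in (coeff_index n d) (\<Sum>v\<le>n. Poly_Mapping.lookup J v * 1)"
    by (intro forms_in_prod forms_in_power value_form_in_forms) auto
  moreover have "(\<Sum>v\<le>n. Poly_Mapping.lookup J v * 1) = d"
    using J monom_degree_superset[of "{..n}" J] by (simp add: monoms_def)
  ultimately have "(\<Prod>v\<le>n. value_form n d w v ^ Poly_Mapping.lookup J v) \<in> forms_in (coeff_index n d) d"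
    by (simp only:)
  from forms_in_mult[OF cst_in_forms this]
  show "cst (a (k, J)) * (\<Prod>v\<le>n. value_form n d w v ^ Poly_Mapping.lookup J v)
      \<in> forms_in (coeff_index n d) d"
    by (simp only: add_0)
qed

section \<open>Points and quotients of forms in projective space\<close>

lemma proj_point_refl: "x \<in> proj_point x"
  by (auto simp: proj_point_def intro!: exI[of _ 1])

text \<open>A point is cut out by the 2 x 2 minors of its coordinates against the
  indeterminates.\<close>

lemma closedin_proj_singleton:
  assumes "M \<in> proj_space I"
  shows "closedin (proj_zariski I) {M}"
proof -
  obtain a where a: "a \<in> affine_space I" "a \<noteq> (\<lambda>_. 0)" "M = proj_point a"
    using assms by (auto simp: proj_space_def)
  define S where "S = {cst (a i) * indet j + cst (- a j) * indet i |i j. i \<in> I \<and> j \<in> I}"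
  have ev: "poly_eval (cst (a i) * indet j + cst (- a j) * indet i) y = a i * y j - a j * y i" for i j y
    unfolding poly_eval_add poly_eval_mult by simp
  have "S \<subseteq> forms_in I 1"
  proof
    fix p assume "p \<in> S"
    then obtain i j where "p = cst (a i) * indet j + cst (- a j) * indet i" "i \<in> I" "j \<in> I"
      unfolding S_def by blast
    then show "p \<in> forms_in I 1"
      by (simp only: forms_in_add cst_indet_in_forms)
  qed
  have "proj_zeros I S = {M}"
  proof (intro set_eqI iffI)
    fix L assume L: "L \<in> proj_zeros I S"
    then have Lp: "L \<in> proj_space I" by (simp add: proj_zeros_def)
    then obtain y where y: "y \<in> affine_space I" "y \<noteq> (\<lambda>_. 0)" "L = proj_point y"
      by (auto simp: proj_space_def)
    have cross: "a i * y j = a j * y i" if "i \<in> I" "j \<in> I" for i j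
    proof -
      have "\<forall>p\<in>S. poly_eval p y = 0"
        using L y(3) proj_point_refl[of y] by (auto simp: proj_zeros_def)
      moreover have "cst (a i) * indet j + cst (- a j) * indet i \<in> S"
        using that by (auto simp: S_def)
      ultimately have "poly_eval (cst (a i) * indet j + cst (- a j) * indet i) y = 0" by blast
      then show ?thesis by (simp only: ev) simp
    qed
    obtain i where i: "a i \<noteq> 0" using a(2) by auto
    then have "i \<in> I" using a(1) by (auto simp: affine_space_def)
    have eq: "y = (\<lambda>j. (y i / a i) * a j)"
    proof
      fix j
      show "y j = (y i / a i) * a j"
        using cross[OF \<open>i \<in> I\<close>, of j] i a(1) y(1)
        by (cases "j \<in> I") (auto simp: field_simps affine_space_def)
    qed
    moreover have "y i / a i \<noteq> 0" using eq y(2) by auto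
    ultimately have "y \<in> M"
      unfolding a(3) proj_point_def by blast
    then have "M = L" using proj_space_rep(3)[OF assms] y(3) by blast
    then show "L \<in> {M}" by simp
  next
    fix L assume "L \<in> {M}"
    then have "L = M" by simp
    have "poly_eval p y = 0" if "p \<in> S" "y \<in> M" for p y
    proof -
      obtain i j where p: "p = cst (a i) * indet j + cst (- a j) * indet i"
        using \<open>p \<in> S\<close> unfolding S_def by blast
      obtain c where "y = (\<lambda>i. c * a i)"
        using \<open>y \<in> M\<close> unfolding a(3) proj_point_def by blast
      then show ?thesis unfolding p ev by simp
    qed
    then show "L \<in> proj_zeros I S"
      using assms by (simp add: proj_zeros_def \<open>L = M\<close>)
  qed
  then have "proj_space I - (proj_space I - {M}) = proj_zeros I S"
    using assms by auto
  moreover have "S \<subseteq> (\<Union>e. forms_in I e)"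
    using \<open>S \<subseteq> forms_in I 1\<close> by auto
  ultimately have op: "openin (proj_zariski I) (proj_space I - {M})"
    unfolding openin_proj_zariski proj_algebraic_set_def by (intro conjI exI[of _ S]) auto
  \<comment> \<open>The whole space is open as the complement of the zeros of the degree 0 form 1;
    this identifies the \<open>topspace\<close>.\<close>
  have "proj_space I - proj_space I = proj_zeros I {1}"
    using proj_point_refl by (auto simp: proj_zeros_def proj_space_def)
  moreover have "{1} \<subseteq> (\<Union>e. forms_in I e)"
    using cst_in_forms[of 1 I] by auto
  ultimately have "openin (proj_zariski I) (proj_space I)"
    unfolding openin_proj_zariski proj_algebraic_set_def by (intro conjI exI[of _ "{1}"]) auto
  moreover have "topspace (proj_zariski I) \<subseteq> proj_space I"
    using openin_topspace[of "proj_zariski I"] unfolding openin_proj_zariski by simp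
  ultimately have "topspace (proj_zariski I) = proj_space I"
    using openin_subset by blast
  then show ?thesis
    using op assms by (simp add: closedin_def)
qed

text \<open>For forms of equal degree the quotient does not depend on the chosen representative of
  the point.\<close>

definition form_ratio :: "'v cpoly \<Rightarrow> 'v cpoly \<Rightarrow> ('v \<Rightarrow> complex) set \<Rightarrow> complex" where
  "form_ratio p q M = (let y = SOME y. y \<in> M in poly_eval p y / poly_eval q y)"

lemma form_ratio_eq:
  assumes "p \<in> forms_in I e" "q \<in> forms_in I e" "M \<in> proj_space I" "y \<in> M"
  shows "form_ratio p q M = poly_eval p y / poly_eval q y"
proof -
  have "(SOME y. y \<in> M) \<in> M" by (rule someI[of "\<lambda>y. y \<in> M", OF assms(4)])
  then obtain c where c: "c \<noteq> 0" "(SOME y. y \<in> M) = (\<lambda>i. c * y i)"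
    using proj_space_rep(3)[OF assms(3,4)] unfolding proj_point_def by auto
  then show ?thesis
    unfolding form_ratio_def Let_def c(2) form_eval_scale[OF assms(1)] form_eval_scale[OF assms(2)]
    by simp
qed

text \<open>By homogeneity a form vanishes at all representatives of a point or at none, so the set
  is the trace of the complement of a zero set.\<close>

lemma openin_form_nonzero:
  assumes "q \<in> forms_in I e"
  shows "openin (subtopology (proj_zariski I) V) {M \<in> proj_space I \<inter> V. \<forall>y\<in>M. poly_eval q y \<noteq> 0}"
proof -
  let ?U = "{M \<in> proj_space I. \<forall>y\<in>M. poly_eval q y \<noteq> 0}"
  have rep: "(\<forall>y\<in>M. poly_eval q y = 0) \<longleftrightarrow> (\<exists>y\<in>M. poly_eval q y = 0)" if M: "M \<in> proj_space I" for M
  proof -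
    have "poly_eval q y' = 0" if y: "y \<in> M" "y' \<in> M" "poly_eval q y = 0" for y y'
    proof -
      obtain c where "y' = (\<lambda>i. c * y i)"
        using proj_space_rep(3)[OF M y(1)] y(2) unfolding proj_point_def by auto
      then show ?thesis using y(3) by (simp add: form_eval_scale[OF assms])
    qed
    moreover have "M \<noteq> {}"
      using M proj_point_refl by (auto simp: proj_space_def)
    ultimately show ?thesis by blast
  qed
  have "proj_space I - ?U = proj_zeros I {q}"
    using rep by (auto simp: proj_zeros_def)
  moreover have "{q} \<subseteq> (\<Union>e. forms_in I e)" using assms by auto
  ultimately have "openin (proj_zariski I) ?U"
    unfolding openin_proj_zariski proj_algebraic_set_def by (intro conjI exI[of _ "{q}"]) auto
  moreover have "{M \<in> proj_space I \<inter> V. \<forall>y\<in>M. poly_eval q y \<noteq> 0} = ?U \<inter> V" by auto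
  ultimately show ?thesis by (simp add: openin_subtopology_Int)
qed

lemma form_ratio_regular:
  assumes "p \<in> forms_in I e" "q \<in> forms_in I e" "openin (zar (proj_fs I V)) O'"
    and "O' \<subseteq> proj_space I" "\<And>M y. M \<in> O' \<Longrightarrow> y \<in> M \<Longrightarrow> poly_eval q y \<noteq> 0"
  shows "form_ratio p q \<in> reg (proj_fs I V) O'"
proof -
  have "\<forall>M\<in>O'. \<forall>y\<in>M. poly_eval q y \<noteq> 0 \<and> form_ratio p q M = poly_eval p y / poly_eval q y"
    using assms(4,5) form_ratio_eq[OF assms(1,2)] by blast
  then have "\<exists>e. \<exists>g\<in>forms_in I e. \<exists>h\<in>forms_in I e. \<forall>M\<in>O'. \<forall>y\<in>M.
      poly_eval h y \<noteq> 0 \<and> form_ratio p q M = poly_eval g y / poly_eval h y"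
    using assms(1,2) by blast
  then show ?thesis
    using assms(3) unfolding proj_fs_def by auto
qed

lemma coeff_proportional_of_grid:
  assumes b: "b \<in> affine_space (coeff_index n d)" and b': "b' \<in> affine_space (coeff_index n d)"
    and "r \<noteq> 0" "k \<noteq> 0"
    and eq: "\<And>w i. w \<in> grid n d r \<Longrightarrow> i \<le> n \<Longrightarrow> k * eval_forms n d b w i = k' * eval_forms n d b' w i"
  shows "b = (\<lambda>j. (k' / k) * b' j)"
proof
  fix j
  show "b j = (k' / k) * b' j"
  proof (cases "j \<in> coeff_index n d")
    case True
    then obtain i J where j: "j = (i, J)" "i \<le> n" "J \<in> monoms n d"
      by (auto simp: coeff_index_def)
    have "(\<lambda>j. k * b j - k' * b' j) (i, J) = 0"
    proof (rule eval_forms_grid_zero[OF assms(3) j(2,3)])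
      fix w assume "w \<in> grid n d r"
      have "eval_forms n d (\<lambda>j. k * b j - k' * b' j) w i = k * eval_forms n d b w i - k' * eval_forms n d b' w i"
        by (simp add: eval_forms_def algebra_simps sum_subtractf sum_distrib_left)
      then show "eval_forms n d (\<lambda>j. k * b j - k' * b' j) w i = 0"
        using eq[OF \<open>w \<in> grid n d r\<close> j(2)] by simp
    qed
    then show ?thesis using j(1) assms(4) by (simp add: field_simps)
  next
    case False
    then have "b j = 0" "b' j = 0" using b b' unfolding affine_space_def by blast+
    then show ?thesis by simp
  qed
qed

lemma vnorm_grid_le:
  assumes "x \<in> grid n d (of_real r)" "r \<ge> 0"
  shows "vnorm n x \<le> of_nat (Suc n) * (of_nat d * r)"
proof -
  have "norm (x i) \<le> of_nat d * r" if i: "i \<in> {..n}" for i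
  proof -
    obtain k where "k \<le> d" "x i = of_nat k * of_real r"
      using assms(1) i by (auto simp: grid_def)
    then show ?thesis using assms(2) by (simp add: norm_mult mult_right_mono)
  qed
  then have "vnorm n x \<le> of_nat (card {..n}) * (of_nat d * r)"
    unfolding vnorm_def by (rule sum_bounded_above)
  then show ?thesis by simp
qed

lemma finite_image_of_determined:
  assumes "finite (F ` W)" "\<And>s t. s \<in> W \<Longrightarrow> t \<in> W \<Longrightarrow> F s = F t \<Longrightarrow> h s = h t"
  shows "finite (h ` W)"
proof -
  have "h t = h (inv_into W F (F t))" if "t \<in> W" for t
    using assms(2)[of t "inv_into W F (F t)"] that by (simp add: inv_into_into f_inv_into_f)
  then have "h ` W \<subseteq> (\<lambda>v. h (inv_into W F v)) ` (F ` W)"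
    by (auto simp: image_image)
  then show ?thesis using assms(1) by (meson finite_imageI finite_subset)
qed


section \<open>Families of commuting endomorphisms\<close>

theorem theorem3p2:
  fixes n d :: nat
    and \<phi> :: "(nat \<times> nat monom \<Rightarrow> complex) set"
    and T :: "'t fun_space"
    and \<psi> :: "'t \<Rightarrow> (nat \<times> nat monom \<Rightarrow> complex) set"
  assumes "d > 1"
    and "\<phi> \<in> Mor n d"
    and "complex_variety T"
    and "irreducible_space (zar T)"
    and "fs_morphism T (Mor_fs n d) \<psi>"
    and "\<forall>t\<in>topspace (zar T). \<forall>P\<in>proj_space {..n}.
           endo n d \<phi> (endo n d (\<psi> t) P) = endo n d (\<psi> t) (endo n d \<phi> P)"
  shows "\<forall>s\<in>topspace (zar T). \<forall>t\<in>topspace (zar T). \<psi> s = \<psi> t"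
proof -

  \<comment> \<open>A grid inside the ball of uniform bounds\<close>
  let ?I = "coeff_index n d" and ?Y = "Mor_fs n d"
  have d0: "d > 0" using assms(1) by simp
  have top: "topspace (zar ?Y) = topspace (proj_zariski ?I) \<inter> Mor n d"
    by (simp add: Mor_fs_def proj_fs_def)
  have cont: "continuous_map (zar T) (zar ?Y) \<psi>"
    using assms(5) by (simp add: fs_morphism_def)
  have psi: "\<psi> t \<in> Mor n d" if "t \<in> topspace (zar T)" for t
    using continuous_map_funspace[OF cont] that top by auto
  have Mor_proj: "Mor n d \<subseteq> proj_space ?I"
    by (auto simp: Mor_def)
  have nonempty: "\<exists>y. y \<in> M" if "M \<in> proj_space ?I" for M
    using that proj_point_refl by (auto simp: proj_space_def)
  obtain a where a: "a \<in> \<phi>" using nonempty assms(2) Mor_proj by blast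
  let ?F = "eval_forms n d a"
  have "topspace (zar T) \<noteq> {}"
    using assms(4) unfolding irreducible_space_def by blast
  then obtain t0 where t0: "t0 \<in> topspace (zar T)" by blast
  obtain b0 where b0: "b0 \<in> \<psi> t0" using nonempty psi[OF t0] Mor_proj by blast
  obtain \<epsilon> R :: real where eR: "\<epsilon> > 0" "R > 0" "\<forall>b c. c \<noteq> 0 \<longrightarrow>
    (\<forall>y\<in>affine_space {..n}. ?F (eval_forms n d b y) = (\<lambda>i. c * eval_forms n d b (?F y) i)) \<longrightarrow>
    (\<exists>l. l ^ (d - 1) * c = 1 \<and> (\<forall>x i. x \<in> affine_space {..n} \<longrightarrow> vnorm n x \<le> \<epsilon> \<longrightarrow>
        norm (l * eval_forms n d b x i) \<le> R))"
    using commuting_normalized_bound[OF assms(2) a assms(1)] by metis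
  \<comment> \<open>Chosen so that grid points for spacing \<open>\<epsilon> / D\<close> have sum
    norm at most \<open>\<epsilon>\<close>.\<close>
  define D where "D = real (Suc n) * real d"
  have "D > 0" using d0 by (simp add: D_def)
  define r where "r = \<epsilon> / D"
  have "of_nat (Suc n) * (of_nat d * r) = D * r"
    by (simp only: D_def mult.assoc)
  with \<open>D > 0\<close> have r: "r > 0" "of_nat (Suc n) * (of_nat d * r) = \<epsilon>"
    using eR(1) by (simp_all add: r_def)
  define \<Gamma> where "\<Gamma> = grid n d (of_real r)"
  have r0: "complex_of_real r \<noteq> 0" using r(1) by simp
  have \<Gamma>: "w \<in> affine_space {..n}" "vnorm n w \<le> \<epsilon>" if "w \<in> \<Gamma>" for w
    using that vnorm_grid_le[of w n d r] r by (auto simp: \<Gamma>_def grid_def)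
  have repr: "b \<in> affine_space ?I" "b \<noteq> (\<lambda>_. 0)" if "t \<in> topspace (zar T)" "b \<in> \<psi> t" for t b
    using proj_space_rep[of "\<psi> t" ?I b] psi Mor_proj that by auto
  \<comment> \<open>Forms vanishing on the grid would have zero coefficients; the nonzero value
    found here becomes the auxiliary factor \<open>l\<close>.\<close>
  have "\<exists>w\<in>\<Gamma>. \<exists>i\<le>n. eval_forms n d b0 w i \<noteq> 0"
  proof (rule ccontr)
    assume "\<not> ?thesis"
    then have z: "eval_forms n d b0 w i = 0" if "w \<in> \<Gamma>" "i \<le> n" for w i
      using that by blast
    have "b0 j = 0" for j
    proof (cases "j \<in> ?I")
      case True
      then obtain i J where "j = (i, J)" "i \<le> n" "J \<in> monoms n d" by (auto simp: coeff_index_def)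
      then show ?thesis using eval_forms_grid_zero[OF r0, of i n J d b0] z by (simp add: \<Gamma>_def)
    next
      case False
      then show ?thesis using repr(1)[OF t0 b0] unfolding affine_space_def by blast
    qed
    then show False using repr(2)[OF t0 b0] by blast
  qed
  then obtain w0 i0 where w0: "w0 \<in> \<Gamma>" "i0 \<le> n" "eval_forms n d b0 w0 i0 \<noteq> 0"
    by blast

  \<comment> \<open>Regular functions on the space of endomorphisms\<close>
  have "?F (eval_forms n d b0 w0) \<noteq> (\<lambda>_. 0)"
  proof
    assume "?F (eval_forms n d b0 w0) = (\<lambda>_. 0)"
    then have "eval_forms n d b0 w0 = (\<lambda>_. 0)"
      using assms(2) a eval_forms_in_affine_space[of n d b0 w0] unfolding Mor_def by blast
    then show False using w0(3) by simp
  qed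
  then obtain k where k: "?F (eval_forms n d b0 w0) k \<noteq> 0" by auto
  then have kn: "k \<le> n" by (auto simp: eval_forms_def split: if_splits)
  \<comment> \<open>For a variable lift G, \<open>q\<close> is F(G w0)_k and \<open>p w i\<close> is
    G(w)_i G(w0)_i0^(d-2) G(F w0)_k, both of degree d since 1 + (d-2) + 1 = d. As F(G w0)_k = c G(F
    w0)_k, their quotient is G(w)_i G(w0)_i0^(d-2) / c, so division by the unknown c is achieved by
    a quotient of forms.\<close>
  define q where "q = composite_form n d a w0 k"
  define l where "l = value_form n d w0 i0"
  define p where "p w i = value_form n d w i * (l ^ (d - 2) * value_form n d (?F w0) k)" for w i
  have q: "q \<in> forms_in ?I d" unfolding q_def by (rule composite_form_in_forms)
  have l: "l \<in> forms_in ?I 1" unfolding l_def by (rule value_form_in_forms[OF w0(2)])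
  have p: "p w i \<in> forms_in ?I d" if "i \<le> n" for w i
  proof -
    have "p w i \<in> forms_in ?I (1 + ((d - 2) * 1 + 1))"
      unfolding p_def by (intro forms_in_mult forms_in_power l value_form_in_forms that kn)
    then show ?thesis using assms(1) by (simp add: numeral_2_eq_2 Suc_diff_Suc)
  qed
  \<comment> \<open>On this set the denominator is nonzero, and so is G(w0)_i0, which makes the
    factor \<open>\<mu>\<close> below nonzero.\<close>
  define O' where "O' = {M \<in> proj_space ?I \<inter> Mor n d. \<forall>y\<in>M. poly_eval (q * l) y \<noteq> 0}"
  have O': "openin (zar ?Y) O'"
    unfolding O'_def Mor_fs_def using openin_form_nonzero[OF forms_in_mult[OF q l]] by (simp add: proj_fs_def)
  define OT where "OT = {t \<in> topspace (zar T). \<psi> t \<in> O'}"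
  have OT: "openin (zar T) OT"
    unfolding OT_def by (rule openin_continuous_map_preimage[OF cont O'])
  have "poly_eval (q * l) y \<noteq> 0" if y: "y \<in> \<psi> t0" for y
  proof -
    have "\<psi> t0 = proj_point b0" using proj_space_rep(3) b0 psi[OF t0] Mor_proj by blast
    then obtain c where "c \<noteq> 0" "y = (\<lambda>i. c * b0 i)"
      using y unfolding proj_point_def by auto
    then show ?thesis
      unfolding poly_eval_mult using k w0(3)
      by (simp add: form_eval_scale[OF q] form_eval_scale[OF l])
        (simp add: q_def l_def poly_eval_composite_form[OF kn] poly_eval_value_form[OF w0(2)])
  qed
  then have t0O: "t0 \<in> OT"
    using t0 psi[OF t0] Mor_proj by (auto simp: OT_def O'_def)
  define f where "f w i = form_ratio (p w i) q" for w i
  \<comment> \<open>The values of the functions \<open>f w i\<close> recover the lift up to a common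
    nonzero factor, and on the grid they are bounded independently of \<open>t\<close>.\<close>
  have factor: "\<exists>\<mu>. \<mu> \<noteq> 0 \<and> (\<forall>w i. i \<le> n \<longrightarrow> f w i (\<psi> t) = \<mu> * eval_forms n d b w i) \<and>
      (\<forall>w i. w \<in> \<Gamma> \<longrightarrow> i \<le> n \<longrightarrow> norm (\<mu> * eval_forms n d b w i) \<le> R ^ (d - 1))"
    if t: "t \<in> OT" and b: "b \<in> \<psi> t" for t b
  proof -
    let ?G = "eval_forms n d b"
    have tT: "t \<in> topspace (zar T)" using t by (simp add: OT_def)
    have comm: "\<forall>P\<in>proj_space {..n}. endo n d \<phi> (endo n d (\<psi> t) P) = endo n d (\<psi> t) (endo n d \<phi> P)"
      using assms(6) tT by blast
    obtain c where c: "c \<noteq> 0" "\<forall>x\<in>affine_space {..n}. ?F (?G x) = (\<lambda>i. c * ?G (?F x) i)"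
      using commuting_lifts[OF assms(2) psi[OF tT] a b d0 comm] by blast
    obtain m where m: "m ^ (d - 1) * c = 1"
        "\<forall>x i. x \<in> affine_space {..n} \<longrightarrow> vnorm n x \<le> \<epsilon> \<longrightarrow> norm (m * ?G x i) \<le> R"
      using eR(3)[rule_format, OF c(1) bspec[OF c(2)]] by blast
    have "poly_eval (q * l) b \<noteq> 0"
      using t b by (simp add: OT_def O'_def)
    then have nz: "?F (?G w0) k \<noteq> 0" "?G w0 i0 \<noteq> 0"
      by (simp_all add: poly_eval_mult q_def l_def poly_eval_composite_form[OF kn]
          poly_eval_value_form[OF w0(2)])
    have Fk: "?F (?G w0) k = c * ?G (?F w0) k"
      using fun_cong[OF bspec[OF c(2) \<Gamma>(1)[OF w0(1)]], of k] .
    define \<mu> where "\<mu> = ?G w0 i0 ^ (d - 2) / c"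
    have val: "f w i (\<psi> t) = \<mu> * ?G w i" if "i \<le> n" for w i
    proof -
      have "f w i (\<psi> t) = poly_eval (p w i) b / poly_eval q b"
        unfolding f_def using psi[OF tT] Mor_proj b by (intro form_ratio_eq[OF p[OF that] q]) auto
      also have "\<dots> = ?G w i * (?G w0 i0 ^ (d - 2) * ?G (?F w0) k) / (c * ?G (?F w0) k)"
        by (simp add: p_def q_def l_def poly_eval_mult poly_eval_power Fk
            poly_eval_composite_form[OF kn] poly_eval_value_form that kn w0(2))
      also have "\<dots> = \<mu> * ?G w i"
        using nz(1) Fk by (simp add: \<mu>_def)
      finally show ?thesis .
    qed
    have "d - 1 = Suc (d - 2)" using assms(1) by simp
    have "c * (m * m ^ (d - 2)) = 1"
      using m(1) unfolding \<open>d - 1 = Suc (d - 2)\<close> by (simp add: mult.commute)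
    then have "inverse c = m * m ^ (d - 2)"
      by (rule inverse_unique)
    \<comment> \<open>Since \<open>inverse c\<close> is \<open>m ^ (d - 1)\<close>, one factor
      \<open>m\<close> goes to each of the \<open>d - 2\<close> values at \<open>w0\<close> and one
      to \<open>z\<close>; only the bounded multiple mG of the lift then occurs.\<close>
    then have \<mu>: "\<mu> * z = (m * ?G w0 i0) ^ (d - 2) * (m * z)" for z
      by (simp add: \<mu>_def divide_inverse power_mult_distrib)
    have "norm (\<mu> * ?G w i) \<le> R ^ (d - 1)" if "w \<in> \<Gamma>" for w i
    proof -
      have "norm (\<mu> * ?G w i) = norm (m * ?G w0 i0) ^ (d - 2) * norm (m * ?G w i)"
        unfolding \<mu> norm_mult norm_power by simp
      also have "\<dots> \<le> R ^ (d - 2) * R"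
        using m(2) \<Gamma> w0(1) that eR(2) by (intro mult_mono power_mono) auto
      finally show ?thesis unfolding \<open>d - 1 = Suc (d - 2)\<close> by (simp add: mult.commute)
    qed
    then show ?thesis
      using val nz(2) c(1) by (intro exI[of _ \<mu>]) (auto simp: \<mu>_def)
  qed

  \<comment> \<open>Finitely many values near the base point\<close>
  have "\<exists>W. openin (zar T) W \<and> t0 \<in> W \<and> W \<subseteq> OT \<and> finite ((f w i \<circ> \<psi>) ` W)"
    if wi: "w \<in> \<Gamma>" "i \<le> n" for w i
  proof (rule variety_regular_bounded_locally_finite[OF assms(3) OT _ t0O])
    have "f w i \<in> reg ?Y O'"
      unfolding f_def Mor_fs_def
    proof (rule form_ratio_regular[OF p[OF wi(2)] q])
      show "openin (zar (proj_fs ?I (Mor n d))) O'" using O' by (simp add: Mor_fs_def)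
    qed (auto simp: O'_def poly_eval_mult)
    then show "f w i \<circ> \<psi> \<in> reg T OT"
      using assms(5) O' unfolding fs_morphism_def OT_def by blast
    show "norm ((f w i \<circ> \<psi>) t) \<le> R ^ (d - 1)" if t: "t \<in> OT" for t
    proof -
      have "\<psi> t \<in> proj_space ?I" using t by (simp add: OT_def O'_def)
      then obtain b where "b \<in> \<psi> t" using nonempty by blast
      then obtain \<mu> where "f w i (\<psi> t) = \<mu> * eval_forms n d b w i"
          "norm (\<mu> * eval_forms n d b w i) \<le> R ^ (d - 1)"
        using factor[OF t] wi by blast
      then show ?thesis by simp
    qed
  qed
  then have "\<forall>x\<in>\<Gamma> \<times> {..n}. \<exists>W. openin (zar T) W \<and> t0 \<in> W \<and> W \<subseteq> OT \<and>
      finite ((\<lambda>t. f (fst x) (snd x) (\<psi> t)) ` W)"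
    by (auto simp: comp_def)
  from bchoice[OF this] obtain W where W: "\<forall>x\<in>\<Gamma> \<times> {..n}. openin (zar T) (W x) \<and> t0 \<in> W x \<and>
      W x \<subseteq> OT \<and> finite ((\<lambda>t. f (fst x) (snd x) (\<psi> t)) ` W x)"
    by (rule exE)
  define W' where "W' = (\<Inter>x\<in>\<Gamma> \<times> {..n}. W x)"
  \<comment> \<open>Finiteness of the index set makes the intersection \<open>W'\<close> open; the
    member \<open>(w0, i0)\<close> shows that the intersection is not over the empty family.\<close>
  have fin: "finite (\<Gamma> \<times> {..n})" and ne: "(w0, i0) \<in> \<Gamma> \<times> {..n}"
    using w0 finite_grid by (auto simp: \<Gamma>_def)
  have W'open: "openin (zar T) W'"
    unfolding W'_def using W fin ne by (intro openin_Inter) auto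
  have W't0: "t0 \<in> W'" using W by (auto simp: W'_def)
  have W'sub: "W' \<subseteq> W x" if "x \<in> \<Gamma> \<times> {..n}" for x
    using that by (auto simp: W'_def)
  have W'OT: "W' \<subseteq> OT"
    using bspec[OF W ne] W'sub[OF ne] by (meson subset_trans)
  \<comment> \<open>The tuple of all functions, restricted to the finite index set so that its
    values lie in a finite product of finite sets.\<close>
  define \<Phi> where "\<Phi> t = restrict (\<lambda>x. f (fst x) (snd x) (\<psi> t)) (\<Gamma> \<times> {..n})" for t
  have "\<Phi> ` W' \<subseteq> PiE (\<Gamma> \<times> {..n}) (\<lambda>x. (\<lambda>t. f (fst x) (snd x) (\<psi> t)) ` W x)"
  proof (intro image_subsetI)
    fix t assume "t \<in> W'"
    then have "f (fst x) (snd x) (\<psi> t) \<in> (\<lambda>t. f (fst x) (snd x) (\<psi> t)) ` W x"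
      if "x \<in> \<Gamma> \<times> {..n}" for x
      using W'sub[OF that] by (intro imageI) (rule subsetD)
    then show "\<Phi> t \<in> PiE (\<Gamma> \<times> {..n}) (\<lambda>x. (\<lambda>t. f (fst x) (snd x) (\<psi> t)) ` W x)"
      unfolding \<Phi>_def by (rule restrict_PiE_iff[THEN iffD2, rule_format])
  qed
  moreover have "finite ((\<lambda>t. f (fst x) (snd x) (\<psi> t)) ` W x)" if "x \<in> \<Gamma> \<times> {..n}" for x
    using bspec[OF W that] by (elim conjE)
  ultimately have "finite (\<Phi> ` W')"
    by (rule finite_subset[OF _ finite_PiE[OF fin]])
  then have finite_values: "finite (\<psi> ` W')"
  proof (rule finite_image_of_determined)
    \<comment> \<open>For equal tuples the lifts scaled by \<open>\<mu>\<close> and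
      \<open>\<mu>'\<close> agree on the grid, so \<open>b\<close> and \<open>b'\<close> are
      proportional and represent the same point.\<close>
    fix s t assume st: "s \<in> W'" "t \<in> W'" "\<Phi> s = \<Phi> t"
    have f_eq: "f w i (\<psi> s) = f w i (\<psi> t)" if "w \<in> \<Gamma>" "i \<le> n" for w i
      using fun_cong[OF st(3), of "(w, i)"] that by (simp add: \<Phi>_def)
    have sO: "s \<in> OT" and tO: "t \<in> OT" using st W'OT by auto
    then have sP: "\<psi> s \<in> proj_space ?I" and tP: "\<psi> t \<in> proj_space ?I"
      and sT: "s \<in> topspace (zar T)" and tT: "t \<in> topspace (zar T)"
      by (simp_all add: OT_def O'_def)
    obtain b b' where b: "b \<in> \<psi> s" and b': "b' \<in> \<psi> t" using nonempty sP tP by blast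
    obtain \<mu> where \<mu>: "\<mu> \<noteq> 0" "\<forall>w i. i \<le> n \<longrightarrow> f w i (\<psi> s) = \<mu> * eval_forms n d b w i"
      using factor[OF sO b] by blast
    obtain \<mu>' where \<mu>': "\<mu>' \<noteq> 0" "\<forall>w i. i \<le> n \<longrightarrow> f w i (\<psi> t) = \<mu>' * eval_forms n d b' w i"
      using factor[OF tO b'] by blast
    have "b = (\<lambda>j. (\<mu>' / \<mu>) * b' j)"
      using f_eq \<mu> \<mu>' by (intro coeff_proportional_of_grid[OF repr(1)[OF sT b] repr(1)[OF tT b'] r0])
        (auto simp: \<Gamma>_def)
    then have "b \<in> proj_point b'"
      using \<mu>(1) \<mu>'(1) unfolding proj_point_def by (auto intro!: exI[of _ "\<mu>' / \<mu>"])
    then have "b \<in> \<psi> t" using proj_space_rep(3)[OF tP b'] by simp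
    then show "\<psi> s = \<psi> t"
      using proj_space_rep(3)[OF tP] proj_space_rep(3)[OF sP b] by metis
  qed
  \<comment> \<open>Points are closed, so the fibres of \<open>\<psi>\<close> over these values are
    closed, as the irreducibility argument requires.\<close>
  have closed_values: "closedin (zar ?Y) {M}" if "M \<in> \<psi> ` W'" for M
  proof -
    have "M \<in> Mor n d" using that W'OT by (auto simp: OT_def O'_def)
    then show ?thesis
      using closedin_proj_singleton[of M ?I] Mor_proj
      by (auto simp: Mor_fs_def proj_fs_def closedin_subtopology intro!: exI[of _ "{M}"])
  qed
  have "W' \<noteq> {}" using W't0 by blast
  show ?thesis
    by (intro ballI)
      (rule irreducible_constant[OF assms(4) cont W'open \<open>W' \<noteq> {}\<close> finite_values closed_values])
qed

end
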